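(* Let $\mathcal D$ be a bounded subset of $\mathbb R^d$ that contains an open $d$-dimensional ball, and let $Y(s)=X(s)\beta+W(s)$ for $s\in\mathcal D$, where $X$ and $W$ are independent stationary (zero-mean) Gaussian random fields with spectral densities $f_X(\omega)$ and $f_W(\omega)$ that are positive, continuous, bounded away from $0$ and $\infty$ as $\omega\to0$, and satisfy, for all $\omega\in\mathbb R^d$, $$c_1\phi_X^2(\omega)\le f_X(\omega)\le c_2\phi_X^2(\omega),\qquad c_1\phi_W^2(\omega)\le f_W(\omega)\le c_2\phi_W^2(\omega),$$ for some universal positive constants $c_1,c_2$ and real-valued positive functions $\phi_X,\phi_W$ that are Fourier transforms of functions that are in $L_2(\mathcal D^* )$ for some bounded set $\mathcal D^*\supseteq\mathcal D$ and are zero outside $\mathcal D^*$. If $$\sup_{\omega\in\mathbb R^d}\frac{f_X(\omega)}{f_W(\omega)}<\infty\qquad\text{and}\qquad\int_{\mathbb R^d}\frac{f_X(\omega)}{f_W(\omega)}\,d\omega<\infty,$$ then the measures on the paths of $(X,Y)$ on $\mathcal D$ are equivalent for different values of $\beta$; i.e., there can be no consistent estimator of $\beta$ even if the entire $(X,Y)$ process were observed on $\mathcal D$.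
   Context: The spectral density $f$ of a stationary field with covariance $C$ satisfies $C(h)=\int_{\mathbb R^d}\exp(\iota h^T\omega)f(\omega)\,d\omega$, with $f$ integrable. The Fourier transform of $g$ is $(2\pi)^{-d}\int_{\mathbb R^d}\exp(-\iota h^T\omega)g(h)\,dh$. The measure on the paths is the law of $\{(X(s),Y(s)):s\in\mathcal D\}$ on the $\sigma$-algebra generated by point evaluations; two measures are equivalent if they are mutually absolutely continuous. *)

theory Defs
  imports "HOL-Probability.Probability"
begin

text \<open>Point masses are admitted as degenerate Gaussians, as is usual for Gaussian vectors with a
  possibly singular covariance matrix.\<close>

definition gaussian_rv :: "'a measure \<Rightarrow> ('a \<Rightarrow> real) \<Rightarrow> bool" where
  "gaussian_rv M Z \<longleftrightarrow> Z \<in> borel_measurable M \<and>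
     (\<exists>\<mu> \<sigma>. (\<sigma> > 0 \<and> distributed M lborel Z (\<lambda>z. ennreal (normal_density \<mu> \<sigma> z)))
           \<or> (\<sigma> = 0 \<and> (AE x in M. Z x = \<mu>)))"

text \<open>Joint Gaussianity of the finite-dimensional distributions, expressed by the usual requirement
  that every finite linear combination is Gaussian.\<close>

definition gaussian_field :: "'a measure \<Rightarrow> ('s \<Rightarrow> 'a \<Rightarrow> real) \<Rightarrow> bool" where
  "gaussian_field M Z \<longleftrightarrow>
     (\<forall>S a. finite S \<longrightarrow> gaussian_rv M (\<lambda>x. \<Sum>s\<in>S. a s * Z s x))"

definition covariance :: "'a measure \<Rightarrow> ('a \<Rightarrow> real) \<Rightarrow> ('a \<Rightarrow> real) \<Rightarrow> real" where
  "covariance M U V =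
     (LINT x|M. (U x - (LINT y|M. U y)) * (V x - (LINT y|M. V y)))"

definition stationary_with_covariance ::
    "'a measure \<Rightarrow> ('s::ab_group_add \<Rightarrow> 'a \<Rightarrow> real) \<Rightarrow> ('s \<Rightarrow> real) \<Rightarrow> bool" where
  "stationary_with_covariance M Z C \<longleftrightarrow>
     (\<exists>m. \<forall>s. (LINT x|M. Z s x) = m) \<and> (\<forall>s t. covariance M (Z s) (Z t) = C (s - t))"

definition zero_mean :: "'a measure \<Rightarrow> ('s \<Rightarrow> 'a \<Rightarrow> real) \<Rightarrow> bool" where
  "zero_mean M Z \<longleftrightarrow> (\<forall>s. (LINT x|M. Z s x) = 0)"

definition spectral_density :: "(real ^ 'n \<Rightarrow> real) \<Rightarrow> (real ^ 'n \<Rightarrow> real) \<Rightarrow> bool" where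
  "spectral_density C f \<longleftrightarrow> integrable lborel f \<and>
     (\<forall>h. complex_of_real (C h) =
        (LINT w|lborel. exp (\<i> * complex_of_real (h \<bullet> w)) * complex_of_real (f w)))"

definition stationary_gaussian_field ::
    "'a measure \<Rightarrow> (real ^ 'n \<Rightarrow> 'a \<Rightarrow> real) \<Rightarrow> (real ^ 'n \<Rightarrow> real) \<Rightarrow> bool" where
  "stationary_gaussian_field M Z f \<longleftrightarrow>
     gaussian_field M Z \<and> zero_mean M Z \<and>
     (\<exists>C. stationary_with_covariance M Z C \<and> spectral_density C f)"

definition independent_fields ::
    "'a measure \<Rightarrow> ('s \<Rightarrow> 'a \<Rightarrow> real) \<Rightarrow> ('s \<Rightarrow> 'a \<Rightarrow> real) \<Rightarrow> bool" where
  "independent_fields M X W \<longleftrightarrow>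
     prob_space.indep_var M (Pi\<^sub>M UNIV (\<lambda>_. borel)) (\<lambda>x s. X s x)
                            (Pi\<^sub>M UNIV (\<lambda>_. borel)) (\<lambda>x s. W s x)"

definition bounded_away_from_0_and_infinity_at_origin :: "(real ^ 'n \<Rightarrow> real) \<Rightarrow> bool" where
  "bounded_away_from_0_and_infinity_at_origin f \<longleftrightarrow>
     (\<exists>a b. 0 < a \<and> (\<forall>\<^sub>F w in at 0. a \<le> f w \<and> f w \<le> b))"

definition fourier_transform :: "(real ^ 'n \<Rightarrow> complex) \<Rightarrow> real ^ 'n \<Rightarrow> complex" where
  "fourier_transform g w =
     complex_of_real (1 / (2 * pi) ^ CARD('n)) *
       (LINT h|lebesgue. exp (- \<i> * complex_of_real (h \<bullet> w)) * g h)"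

definition L2_on :: "(real ^ 'n) set \<Rightarrow> (real ^ 'n \<Rightarrow> complex) \<Rightarrow> bool" where
  "L2_on S g \<longleftrightarrow> S \<in> sets lebesgue \<and> g \<in> borel_measurable (lebesgue_on S) \<and>
     integrable (lebesgue_on S) (\<lambda>h. (cmod (g h))\<^sup>2)"

definition fourier_transform_of_L2_supported_in ::
    "(real ^ 'n) set \<Rightarrow> (real ^ 'n \<Rightarrow> real) \<Rightarrow> bool" where
  "fourier_transform_of_L2_supported_in S \<phi> \<longleftrightarrow>
     (\<exists>g. L2_on S g \<and> (\<forall>h. h \<notin> S \<longrightarrow> g h = 0) \<and>
          (\<forall>w. complex_of_real (\<phi> w) = fourier_transform g w))"

definition path_law ::
    "'a measure \<Rightarrow> 's set \<Rightarrow> ('s \<Rightarrow> 'a \<Rightarrow> real) \<Rightarrow> ('s \<Rightarrow> 'a \<Rightarrow> real) \<Rightarrow> ('s \<Rightarrow> real \<times> real) measure" where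
  "path_law M D X Y =
     distr M (Pi\<^sub>M D (\<lambda>_. borel)) (\<lambda>x. \<lambda>s\<in>D. (X s x, Y s x))"

definition equivalent_measures :: "'b measure \<Rightarrow> 'b measure \<Rightarrow> bool" where
  "equivalent_measures P Q \<longleftrightarrow>
     sets P = sets Q \<and> absolutely_continuous P Q \<and> absolutely_continuous Q P"

text \<open>Estimators are sequences of measurable functionals of the whole observation, so that
  estimators using finer and finer finite samples and a single functional of the entire observation
  (a constant sequence) are both covered. Consistency is convergence in probability to the true
  parameter, whatever its value.\<close>

definition consistent_estimator :: "(real \<Rightarrow> 'b measure) \<Rightarrow> (nat \<Rightarrow> 'b \<Rightarrow> real) \<Rightarrow> bool" where
  "consistent_estimator P T \<longleftrightarrow>
     (\<forall>\<beta> n. T n \<in> borel_measurable (P \<beta>)) \<and>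
     (\<forall>\<beta> \<epsilon>. \<epsilon> > 0 \<longrightarrow>
        (\<lambda>n. measure (P \<beta>) {p \<in> space (P \<beta>). \<bar>T n p - \<beta>\<bar> > \<epsilon>}) \<longlonglongrightarrow> 0)"

end

theory Submission
  imports Defs
begin

text \<open>Conditionally on \<open>X\<close>, changing \<open>\<beta>\<close> shifts the Gaussian field \<open>W\<close> by a multiple of the path
  of \<open>X\<close>. On finitely many points choose linear combinations \<open>W\<^sub>k\<close> of the \<open>W(s)\<close> that are orthonormal;
  with the same coefficients \<open>X\<^sub>k\<close> for \<open>X\<close>, the log-likelihood ratio is
  \<open>\<delta> \<Sum>k. X\<^sub>k W\<^sub>k + \<delta>\<^sup>2/2 \<Sum>k. X\<^sub>k\<^sup>2\<close>, so it is tight as soon as \<open>\<Sum>k. E X\<^sub>k\<^sup>2\<close> is bounded independently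
  of the points. If \<open>u\<^sub>k\<close> is the trigonometric polynomial of \<open>W\<^sub>k\<close>, that sum is
  \<open>\<integral> (\<Sum>k. \<bar>u\<^sub>k\<bar>\<^sup>2) f\<^sub>X\<close>, and it suffices that \<open>\<Sum>k. \<bar>u\<^sub>k\<bar>\<^sup>2 \<le> C / f\<^sub>W\<close> pointwise. This holds because
  \<open>u \<phi>\<^sub>W\<close> is the Fourier transform of a function supported in a fixed bounded set, hence reproduced by
  convolution with a fixed square integrable kernel, so that its values are controlled by its
  \<open>L\<^sup>2\<close> norm. Tightness gives \<open>P\<^bsub>\<beta>'\<^esub>(A) \<le> e\<^sup>L P\<^bsub>\<beta>\<^esub>(A) + K/L\<close> for cylinder sets and then for
  all measurable \<open>A\<close>, which yields both equivalence and the absence of consistent estimators.\<close>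

section \<open>A kernel reproducing band-limited functions\<close>

text \<open>A likelihood ratio of Gaussian shifts is in general unbounded, so no purely
  multiplicative inequality between the laws can be expected; the additive error pays for the event
  where the ratio is large. Since the resulting bound does not mention the observation points, it
  passes to the path space without exhibiting a density there. The delicate point is this
  uniformity: \<Sum>k |u_k(w)|^2 can only grow as points are added. Nothing is assumed about the
  transform of \<open>fW\<close> itself, so the band limitation is that of \<open>\<phi>W\<close>,
  and the two-sided comparison exchanges \<open>fW\<close> and \<open>\<phi>W^2\<close> at the price
  of a factor \<open>c2 / c1\<close>. The integral of \<open>fX / fW\<close> then appears because
  the kernel diagonal is capped by a multiple of \<open>1 / fW\<close> and is integrated against
  \<open>fX\<close>. The kernel must be integrable, for Fubini, and square integrable, for the
  Cauchy-Schwarz inequality. The sinc kernel fails the first requirement because its transform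
  jumps; a trapezoid has the same flat top and decays fast enough.\<close>

lemma one_minus_cos_div_square_integrable: "integrable lborel (\<lambda>x::real. (1 - cos x) / x\<^sup>2)"
proof (rule Bochner_Integration.integrable_bound)
  have "set_integrable lborel (einterval (-\<infinity>) \<infinity>) (\<lambda>x. inverse (1 + x^2))"
    by (rule integrable_inverse_1_plus_square)
  then show "integrable lborel (\<lambda>x::real. 4 * inverse (1 + x^2))"
    by (simp add: set_integrable_def)
  show "(\<lambda>x::real. (1 - cos x) / x\<^sup>2) \<in> borel_measurable lborel" by measurable
  show "AE x::real in lborel. norm ((1 - cos x) / x\<^sup>2) \<le> norm (4 * inverse (1 + x\<^sup>2))"
  proof (intro AE_I2)
    fix x :: real
    have half: "1 - cos x \<le> x\<^sup>2 / 2"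
    proof -
      have "1 - cos x = 2 * (sin (x/2))\<^sup>2"
        using cos_double_sin[of "x/2"] by simp
      also have "(sin (x/2))\<^sup>2 \<le> (x/2)\<^sup>2"
        using abs_sin_x_le_abs_x[of "x/2"] abs_le_square_iff by blast
      finally show ?thesis by (simp add: power2_eq_square)
    qed
    have two: "1 - cos x \<le> 2" using cos_ge_minus_one[of x] by linarith
    \<comment> \<open>The quadratic bound serves near the origin and the bound by 2 far from it;
      with the split at \<open>x^2 = 1\<close> the constant 4 covers both.\<close>
    have "(1 - cos x) * (1 + x\<^sup>2) \<le> 4 * x\<^sup>2"
    proof (cases "x\<^sup>2 \<le> 1")
      case True
      have "(1 - cos x) * (1 + x\<^sup>2) \<le> (x\<^sup>2/2) * 2"
        using half True by (intro mult_mono) auto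
      also have "\<dots> \<le> 4 * x\<^sup>2" by simp
      finally show ?thesis .
    next
      case False
      have "(1 - cos x) * (1 + x\<^sup>2) \<le> 2 * (1 + x\<^sup>2)"
        using two by (intro mult_right_mono) auto
      also have "\<dots> \<le> 4 * x\<^sup>2" using False by simp
      finally show ?thesis .
    qed
    moreover have "0 < 1 + x\<^sup>2" by (smt (verit) zero_le_power2)
    ultimately show "norm ((1 - cos x) / x\<^sup>2) \<le> norm (4 * inverse (1 + x\<^sup>2))"
      by (cases "x = 0") (simp_all add: divide_simps abs_mult)
  qed
qed

lemma integral_one_minus_cos_div_square:
  fixes a :: real
  shows "integrable lborel (\<lambda>x. (1 - cos (a * x)) / x\<^sup>2)"
    and "(LINT x|lborel. (1 - cos (a * x)) / x\<^sup>2) = \<bar>a\<bar> * (LINT x|lborel. (1 - cos x) / x\<^sup>2)"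
proof -
  \<comment> \<open>The argument is written \<open>0 + a * x\<close> to match the affine
    substitution rules for Lebesgue measure.\<close>
  have eq: "(1 - cos (a * x)) / x\<^sup>2 = a\<^sup>2 * ((1 - cos (0 + a * x)) / (0 + a * x)\<^sup>2)" for x
    by (cases "a = 0") (auto simp: power_mult_distrib)
  show "integrable lborel (\<lambda>x. (1 - cos (a * x)) / x\<^sup>2)"
  proof (cases "a = 0")
    case False
    then show ?thesis unfolding eq
      by (intro integrable_mult_right lborel_integrable_real_affine one_minus_cos_div_square_integrable)
  qed simp
  show "(LINT x|lborel. (1 - cos (a * x)) / x\<^sup>2) = \<bar>a\<bar> * (LINT x|lborel. (1 - cos x) / x\<^sup>2)"
  proof (cases "a = 0")
    case False
    have "(LINT x|lborel. (1 - cos x) / x\<^sup>2)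
        = \<bar>a\<bar> *\<^sub>R (LINT x|lborel. (1 - cos (0 + a * x)) / (0 + a * x)\<^sup>2)"
      by (rule lborel_integral_real_affine) fact
    moreover have "(LINT x|lborel. (1 - cos (a * x)) / x\<^sup>2)
        = a\<^sup>2 * (LINT x|lborel. (1 - cos (0 + a * x)) / (0 + a * x)\<^sup>2)"
      unfolding eq by (rule integral_mult_right_zero)
    ultimately show ?thesis by (simp add: power2_eq_square)
  qed simp
qed

text \<open>The integrand is nonnegative, and strictly positive on \<open>{0<..1}\<close>.
  Positivity matters because the kernel below is normalised by dividing by this number.\<close>

lemma integral_one_minus_cos_div_square_pos: "0 < (LINT x|lborel. (1 - cos x) / x\<^sup>2 :: real)"
proof -
  have "(LINT x|lborel. (1 - cos x) / x\<^sup>2 :: real) \<noteq> 0"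
  proof
    assume "(LINT x|lborel. (1 - cos x) / x\<^sup>2 :: real) = 0"
    then have "AE x in lborel. (1 - cos x) / x\<^sup>2 = (0::real)"
      by (subst (asm) integral_nonneg_eq_0_iff_AE[OF one_minus_cos_div_square_integrable]) auto
    moreover have "(1 - cos x) / x\<^sup>2 \<noteq> 0" if "x \<in> {0<..1}" for x :: real
    proof -
      have "cos x < cos 0" using that pi_gt3 by (intro cos_monotone_0_pi) auto
      then show ?thesis using that by simp
    qed
    ultimately have "AE x in lborel. x \<notin> {0<..1::real}" by (auto elim: eventually_mono)
    then have "{0<..1::real} \<in> null_sets lborel" by (subst (asm) AE_iff_null_sets[symmetric]) auto
    then have "emeasure lborel {0<..1::real} = 0" by (rule null_setsD1)
    then show False by simp
  qed
  moreover have "0 \<le> (LINT x|lborel. (1 - cos x) / x\<^sup>2 :: real)"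
    by (intro integral_nonneg_AE) auto
  ultimately show ?thesis by linarith
qed

text \<open>The de la Vallee-Poussin kernel \<open>(cos (R x) - cos (2 R x)) / (c R x\<^sup>2)\<close>, whose Fourier
  transform is a trapezoid. By the scaling \<open>\<integral> (1 - cos (a x)) / x\<^sup>2 dx = c \<bar>a\<bar>\<close> and the product
  formula for cosines, the value of \<open>c\<close> is irrelevant.\<close>

lemma trapezoid_kernel_real:
  fixes R :: real
  assumes R: "R > 0"
  obtains \<eta> :: "real \<Rightarrow> real" where "integrable lborel \<eta>" "integrable lborel (\<lambda>x. (\<eta> x)\<^sup>2)"
    "\<And>h. \<bar>h\<bar> \<le> R \<Longrightarrow> (LINT x|lborel. exp (\<i> * of_real (h * x)) * of_real (\<eta> x)) = 1"
proof -
  define c where "c = (LINT x|lborel. (1 - cos x) / x\<^sup>2 :: real)"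
  have c: "c > 0" unfolding c_def by (rule integral_one_minus_cos_div_square_pos)
  define k where "k a x = (1 - cos (a * x)) / x\<^sup>2" for a x :: real
  have k_int[simp]: "integrable lborel (k a)" and k_eq: "(LINT x|lborel. k a x) = \<bar>a\<bar> * c" for a
    unfolding k_def c_def by (rule integral_one_minus_cos_div_square)+
  define \<eta> where "\<eta> x = (k (2 * R) x - k R x) / (c * R)" for x
  have int: "integrable lborel \<eta>" unfolding \<eta>_def by simp
  have \<eta>_meas[measurable]: "\<eta> \<in> borel_measurable borel" using int by simp
  have even: "\<eta> (- x) = \<eta> x" for x by (simp add: \<eta>_def k_def)
  have k_bound: "\<bar>k a x\<bar> \<le> a\<^sup>2 / 2" for a x
  proof -
    have "1 - cos (a * x) = 2 * (sin (a*x/2))\<^sup>2"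
      using cos_double_sin[of "a*x/2"] by simp
    also have "(sin (a*x/2))\<^sup>2 \<le> (a*x/2)\<^sup>2"
      using abs_sin_x_le_abs_x[of "a*x/2"] abs_le_square_iff by blast
    finally have "1 - cos (a * x) \<le> a\<^sup>2 * x\<^sup>2 / 2" by (simp add: power2_eq_square)
    then show ?thesis
      by (cases "x = 0") (auto simp: k_def divide_simps abs_mult)
  qed
  \<comment> \<open>A bounded integrable function is square integrable, so a crude uniform bound on
    \<open>\<eta>\<close> suffices.\<close>
  define B where "B = ((2*R)\<^sup>2/2 + R\<^sup>2/2) / (c * R)"
  have \<eta>_bound: "\<bar>\<eta> x\<bar> \<le> B" for x
  proof -
    have "\<bar>k (2 * R) x - k R x\<bar> \<le> (2*R)\<^sup>2/2 + R\<^sup>2/2"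
      using k_bound[of "2*R" x] k_bound[of R x] by linarith
    then show ?thesis unfolding \<eta>_def B_def abs_divide using c R
      by (simp only: abs_of_pos mult_pos_pos) (intro divide_right_mono, auto)
  qed
  have sq: "integrable lborel (\<lambda>x. (\<eta> x)\<^sup>2)"
  proof (rule Bochner_Integration.integrable_bound)
    show "integrable lborel (\<lambda>x. B * \<eta> x)" using int by simp
    show "AE x in lborel. norm ((\<eta> x)\<^sup>2) \<le> norm (B * \<eta> x)"
    proof (intro AE_I2)
      fix x
      have "\<bar>\<eta> x\<bar> * \<bar>\<eta> x\<bar> \<le> \<bar>B\<bar> * \<bar>\<eta> x\<bar>"
        using \<eta>_bound[of x] by (intro mult_right_mono) auto
      then show "norm ((\<eta> x)\<^sup>2) \<le> norm (B * \<eta> x)"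
        by (simp add: power2_eq_square abs_mult)
    qed
  qed simp
  have main: "(LINT x|lborel. exp (\<i> * of_real (h * x)) * of_real (\<eta> x)) = 1" if h: "\<bar>h\<bar> \<le> R" for h
  proof -
    have cint: "integrable lborel (\<lambda>x. cos (h * x) * \<eta> x)"
      by (rule Bochner_Integration.integrable_bound[OF int])
        (auto intro!: AE_I2 mult_left_le_one_le simp: abs_mult)
    have sint: "integrable lborel (\<lambda>x. sin (h * x) * \<eta> x)"
      by (rule Bochner_Integration.integrable_bound[OF int])
        (auto intro!: AE_I2 mult_left_le_one_le simp: abs_mult)
    \<comment> \<open>The reflection \<open>x \<mapsto> -x\<close> changes the sign of this integral
      because \<open>\<eta>\<close> is even; only the cosine part survives.\<close>
    have "(LINT x|lborel. sin (h * x) * \<eta> x) = \<bar>-1\<bar> *\<^sub>R (LINT x|lborel. sin (h * (0 + -1 * x)) * \<eta> (0 + -1 * x))"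
      by (rule lborel_integral_real_affine) simp
    also have "\<dots> = - (LINT x|lborel. sin (h * x) * \<eta> x)"
      by (simp add: even)
    finally have s0: "(LINT x|lborel. sin (h * x) * \<eta> x) = 0" by simp
    have expand: "cos (h * x) * \<eta> x
        = (k (2*R + h) x + k (2*R - h) x - k (R + h) x - k (R - h) x) / (2 * c * R)" for x
    proof -
      have p: "cos ((a + h) * x) + cos ((a - h) * x) = 2 * (cos (h * x) * cos (a * x))" for a
        by (simp add: ring_distribs cos_add cos_diff)
      have "k (2*R + h) x + k (2*R - h) x - k (R + h) x - k (R - h) x
          = ((cos ((R + h) * x) + cos ((R - h) * x)) - (cos ((2*R + h) * x) + cos ((2*R - h) * x))) / x\<^sup>2"
        unfolding k_def by (simp only: diff_divide_distrib add_divide_distrib)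
      also have "\<dots> = 2 * (cos (h * x) * (k (2*R) x - k R x))"
        unfolding p k_def by (simp add: diff_divide_distrib algebra_simps)
      finally show ?thesis by (simp add: \<eta>_def)
    qed
    have "(LINT x|lborel. cos (h * x) * \<eta> x)
        = (\<bar>2*R + h\<bar> * c + \<bar>2*R - h\<bar> * c - \<bar>R + h\<bar> * c - \<bar>R - h\<bar> * c) / (2 * c * R)"
      unfolding expand by (simp add: k_eq)
    \<comment> \<open>For \<open>\<bar>h\<bar> \<le> R\<close> all four absolute values open with
      the plus sign and \<open>h\<close> cancels: this is the flat top of the trapezoid.\<close>
    also have "\<dots> = 1"
    proof -
      have "\<bar>2*R + h\<bar> = 2*R + h" "\<bar>2*R - h\<bar> = 2*R - h" "\<bar>R + h\<bar> = R + h" "\<bar>R - h\<bar> = R - h"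
        using h by auto
      then have "\<bar>2*R + h\<bar> * c + \<bar>2*R - h\<bar> * c - \<bar>R + h\<bar> * c - \<bar>R - h\<bar> * c = 2 * c * R"
        by (simp only: ring_distribs) simp
      then show ?thesis using c R by simp
    qed
    finally have c1: "(LINT x|lborel. cos (h * x) * \<eta> x) = 1" .
    have "exp (\<i> * of_real (h * x)) * of_real (\<eta> x)
        = complex_of_real (cos (h * x) * \<eta> x) + \<i> * complex_of_real (sin (h * x) * \<eta> x)" for x
      unfolding cis_conv_exp[symmetric] by (simp add: complex_eq_iff)
    then have "(LINT x|lborel. exp (\<i> * of_real (h * x)) * of_real (\<eta> x))
        = (LINT x|lborel. complex_of_real (cos (h * x) * \<eta> x)) + \<i> * (LINT x|lborel. complex_of_real (sin (h * x) * \<eta> x))"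
      using cint sint by (simp only: Bochner_Integration.integral_add integrable_of_real integrable_mult_right integral_mult_right_zero)
    then show ?thesis unfolding integral_complex_of_real s0 c1 by simp
  qed
  show thesis using that[OF int sq main] .
qed

text \<open>Lebesgue measure on a Euclidean space is the image of the product of one-dimensional
  Lebesgue measures under the coordinate map \<open>?T\<close>, so Fubini for products of
  one-variable functions carries over.\<close>

lemma
  fixes g :: "'b::euclidean_space \<Rightarrow> real \<Rightarrow> 'c::{real_normed_field, banach, second_countable_topology}"
  assumes g: "\<And>b. b \<in> Basis \<Longrightarrow> integrable lborel (g b)"
  shows integrable_lborel_prod: "integrable lborel (\<lambda>x::'b. \<Prod>b\<in>Basis. g b (x \<bullet> b))"
    and integral_lborel_prod:
      "(LINT x|lborel. (\<Prod>b\<in>Basis. g b ((x::'b) \<bullet> b))) = (\<Prod>b\<in>Basis. (LINT y|lborel. g b y))"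
proof -
  interpret product_sigma_finite "\<lambda>_::'b. lborel :: real measure" ..
  let ?P = "\<Pi>\<^sub>M b\<in>(Basis::'b set). (lborel :: real measure)"
  let ?T = "\<lambda>f. \<Sum>b\<in>(Basis::'b set). f b *\<^sub>R b"
  have T[measurable]: "?T \<in> measurable ?P borel" by measurable
  have inner_T: "b \<in> Basis \<Longrightarrow> ?T f \<bullet> b = f b" for f and b :: 'b
    by (simp add: inner_sum_left inner_Basis if_distrib cong: if_cong)
  have [measurable]: "b \<in> Basis \<Longrightarrow> g b \<in> borel_measurable borel" for b using g[of b] by simp
  have m: "(\<lambda>x::'b. \<Prod>b\<in>Basis. g b (x \<bullet> b)) \<in> borel_measurable borel" by measurable
  have eq: "(\<Prod>b\<in>Basis. g b (?T f \<bullet> b)) = (\<Prod>b\<in>Basis. g b (f b))" for f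
    by (intro prod.cong refl) (simp add: inner_T)
  show "integrable lborel (\<lambda>x::'b. \<Prod>b\<in>Basis. g b (x \<bullet> b))"
    by (subst lborel_eq, subst integrable_distr_eq[OF T m])
      (unfold eq, intro product_integrable_prod g, auto)
  show "(LINT x|lborel. (\<Prod>b\<in>Basis. g b ((x::'b) \<bullet> b))) = (\<Prod>b\<in>Basis. (LINT y|lborel. g b y))"
    by (subst lborel_eq, subst integral_distr[OF T m])
      (unfold eq, intro product_integral_prod g, auto)
qed

text \<open>A product of one-dimensional kernels works: every coordinate of \<open>h\<close> is at
  most \<open>norm h\<close> in absolute value, so each factor of the transform equals 1.\<close>

lemma trapezoid_kernel:
  fixes R :: real
  assumes R: "R > 0"
  obtains \<eta> :: "'b::euclidean_space \<Rightarrow> real"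
  where "integrable lborel \<eta>" "integrable lborel (\<lambda>x. (\<eta> x)\<^sup>2)"
    "\<And>h. norm h \<le> R \<Longrightarrow> (LINT x|lborel. exp (\<i> * of_real (h \<bullet> x)) * of_real (\<eta> x)) = 1"
proof -
  obtain \<eta>1 :: "real \<Rightarrow> real" where \<eta>1: "integrable lborel \<eta>1" "integrable lborel (\<lambda>x. (\<eta>1 x)\<^sup>2)"
    "\<And>h. \<bar>h\<bar> \<le> R \<Longrightarrow> (LINT x|lborel. exp (\<i> * of_real (h * x)) * of_real (\<eta>1 x)) = 1"
    using trapezoid_kernel_real[OF R] by metis
  have \<eta>1_meas[measurable]: "\<eta>1 \<in> borel_measurable borel" using \<eta>1(1) by simp
  define \<eta> :: "'b \<Rightarrow> real" where "\<eta> x = (\<Prod>b\<in>Basis. \<eta>1 (x \<bullet> b))" for x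
  have \<eta>_meas[measurable]: "\<eta> \<in> borel_measurable borel" unfolding \<eta>_def by measurable
  have int: "integrable lborel \<eta>" unfolding \<eta>_def by (intro integrable_lborel_prod \<eta>1)
  have sq: "integrable lborel (\<lambda>x. (\<eta> x)\<^sup>2)"
    unfolding \<eta>_def prod_power_distrib by (rule integrable_lborel_prod[where g="\<lambda>_ x. (\<eta>1 x)\<^sup>2"]) (rule \<eta>1)
  have "(LINT x|lborel. exp (\<i> * of_real (h \<bullet> x)) * of_real (\<eta> x)) = 1" if h: "norm h \<le> R" for h :: 'b
  proof -
    have i: "integrable lborel (\<lambda>y. exp (\<i> * of_real ((h \<bullet> b) * y)) * complex_of_real (\<eta>1 y))" for b
      by (rule Bochner_Integration.integrable_bound[OF \<eta>1(1)]) (auto simp: norm_mult)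
    have "exp (\<i> * of_real (h \<bullet> x)) * of_real (\<eta> x)
        = (\<Prod>b\<in>Basis. exp (\<i> * of_real ((h \<bullet> b) * (x \<bullet> b))) * complex_of_real (\<eta>1 (x \<bullet> b)))" for x :: 'b
    proof -
      have "exp (\<i> * of_real (h \<bullet> x)) = (\<Prod>b\<in>Basis. exp (\<i> * of_real ((h \<bullet> b) * (x \<bullet> b))) :: complex)"
        by (subst euclidean_inner) (simp add: exp_sum sum_distrib_left)
      then show ?thesis by (simp add: \<eta>_def prod.distrib)
    qed
    then have "(LINT x|lborel. exp (\<i> * of_real (h \<bullet> x)) * of_real (\<eta> x))
        = (\<Prod>b\<in>Basis. LINT y|lborel. exp (\<i> * of_real ((h \<bullet> b) * y)) * complex_of_real (\<eta>1 y))"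
      by (simp only: integral_lborel_prod[OF i])
    also have "\<dots> = 1"
      using h Basis_le_norm[of _ h] by (intro prod.neutral ballI \<eta>1(3)) (meson order_trans)
    finally show ?thesis .
  qed
  then show thesis using that[OF int sq] by blast
qed

section \<open>Trigonometric polynomials and the trace bound\<close>

text \<open>The spectral image of the random variable \<open>\<Sum>s\<in>S. a s * Z s\<close>: the
  integral of its squared modulus against the spectral density is the second moment, see
  \<open>spectral_second_moment\<close>.\<close>

definition trig_poly :: "'b::euclidean_space set \<Rightarrow> ('b \<Rightarrow> real) \<Rightarrow> 'b \<Rightarrow> complex" where
  "trig_poly S a \<omega> = (\<Sum>s\<in>S. of_real (a s) * exp (\<i> * of_real (s \<bullet> \<omega>)))"

lemma trig_poly_measurable[measurable]: "trig_poly S a \<in> borel_measurable borel"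
  unfolding trig_poly_def[abs_def] by measurable

lemma cmod_trig_poly_le: "cmod (trig_poly S a \<omega>) \<le> (\<Sum>s\<in>S. \<bar>a s\<bar>)"
  unfolding trig_poly_def by (rule order_trans[OF norm_sum]) (simp add: norm_mult)

lemma integrable_trig_poly_square:
  assumes "integrable lborel f"
  shows "integrable lborel (\<lambda>\<omega>. (cmod (trig_poly S a \<omega>))\<^sup>2 * (f \<omega> :: real))"
proof (rule Bochner_Integration.integrable_bound)
  show "integrable lborel (\<lambda>\<omega>. (\<Sum>s\<in>S. \<bar>a s\<bar>)\<^sup>2 * f \<omega>)" using assms by simp
  show "(\<lambda>\<omega>. (cmod (trig_poly S a \<omega>))\<^sup>2 * f \<omega>) \<in> borel_measurable lborel"
    using assms by measurable
  have "(cmod (trig_poly S a \<omega>))\<^sup>2 \<le> (\<Sum>s\<in>S. \<bar>a s\<bar>)\<^sup>2" for \<omega>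
    by (intro power_mono cmod_trig_poly_le) simp
  then show "AE \<omega> in lborel. norm ((cmod (trig_poly S a \<omega>))\<^sup>2 * f \<omega>) \<le> norm ((\<Sum>s\<in>S. \<bar>a s\<bar>)\<^sup>2 * f \<omega>)"
    by (intro AE_I2) (auto simp: abs_mult intro!: mult_right_mono)
qed

text \<open>Up to normalisation, the left-hand side is the Fourier transform of \<open>g\<close>
  translated by \<open>s\<close>. Convolution with \<open>\<eta>\<close> multiplies the translated
  function by the transform of \<open>\<eta>\<close>, which is 1 on its support.\<close>

lemma reproducing_formula:
  fixes g :: "'b::euclidean_space \<Rightarrow> complex" and \<eta> :: "'b \<Rightarrow> real"
  assumes g: "integrable lborel g" and \<eta>: "integrable lborel \<eta>"
    and one: "\<And>h. norm h \<le> R \<Longrightarrow> (LINT x|lborel. exp (\<i> * of_real (h \<bullet> x)) * of_real (\<eta> x)) = 1"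
    and supp: "AE h in lborel. g h = 0 \<or> norm (h - s) \<le> R"
  shows "exp (\<i> * of_real (s \<bullet> \<omega>)) * (LINT h|lborel. exp (- \<i> * of_real (h \<bullet> \<omega>)) * g h)
    = (LINT \<tau>|lborel. exp (\<i> * of_real (s \<bullet> (\<omega> - \<tau>)))
        * (LINT h|lborel. exp (- \<i> * of_real (h \<bullet> (\<omega> - \<tau>))) * g h) * of_real (\<eta> \<tau>))"
proof -
  have [measurable]: "g \<in> borel_measurable borel" "\<eta> \<in> borel_measurable borel" using g \<eta> by simp_all
  define f where "f \<tau> h = exp (\<i> * of_real ((s - h) \<bullet> (\<omega> - \<tau>))) * g h * complex_of_real (\<eta> \<tau>)" for \<tau> h :: 'b
  have norm_f: "norm (f \<tau> h) = norm (g h) * \<bar>\<eta> \<tau>\<bar>" for \<tau> h by (simp add: f_def norm_mult)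
  have f_int: "integrable (lborel \<Otimes>\<^sub>M lborel) (case_prod f)"
  proof (rule lborel_pair.Fubini_integrable)
    show "case_prod f \<in> borel_measurable (lborel \<Otimes>\<^sub>M lborel)" unfolding f_def by measurable
    show "integrable lborel (\<lambda>\<tau>. LINT h|lborel. norm (case (\<tau>, h) of (x, xa) \<Rightarrow> f x xa))"
      using \<eta> by (simp add: norm_f)
    have "integrable lborel (f \<tau>)" for \<tau>
    proof (rule Bochner_Integration.integrable_bound)
      show "integrable lborel (\<lambda>h. cmod (g h) * \<bar>\<eta> \<tau>\<bar>)" using g by simp
      show "f \<tau> \<in> borel_measurable lborel" unfolding f_def[abs_def] by measurable
    qed (simp add: norm_f)
    then show "AE \<tau> in lborel. integrable lborel (\<lambda>h. case (\<tau>, h) of (x, xa) \<Rightarrow> f x xa)" by simp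
  qed
  have e1: "f \<tau> h = exp (\<i> * of_real (s \<bullet> (\<omega> - \<tau>))) * (exp (- \<i> * of_real (h \<bullet> (\<omega> - \<tau>))) * g h) * of_real (\<eta> \<tau>)"
    for \<tau> h
  proof -
    have "exp (\<i> * of_real ((s - h) \<bullet> (\<omega> - \<tau>)))
        = exp (\<i> * of_real (s \<bullet> (\<omega> - \<tau>))) * (exp (- \<i> * of_real (h \<bullet> (\<omega> - \<tau>))) :: complex)"
      unfolding exp_add[symmetric] by (simp add: inner_diff_left algebra_simps)
    then show ?thesis by (simp add: f_def)
  qed
  \<comment> \<open>In this grouping \<open>\<tau>\<close> occurs only in the last bracket, so
    integrating over \<open>\<tau>\<close> first produces the transform of \<open>\<eta>\<close> at
    \<open>h - s\<close>. The grouping \<open>e1\<close> is the one suited to integrating over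
    \<open>h\<close> first.\<close>
  have e2: "f \<tau> h = exp (\<i> * of_real (s \<bullet> \<omega>)) * (exp (- \<i> * of_real (h \<bullet> \<omega>)) * g h)
      * (exp (\<i> * of_real ((h - s) \<bullet> \<tau>)) * of_real (\<eta> \<tau>))" for \<tau> h
  proof -
    have "exp (\<i> * of_real ((s - h) \<bullet> (\<omega> - \<tau>)))
        = exp (\<i> * of_real (s \<bullet> \<omega>)) * exp (- \<i> * of_real (h \<bullet> \<omega>)) * (exp (\<i> * of_real ((h - s) \<bullet> \<tau>)) :: complex)"
      unfolding exp_add[symmetric] by (simp add: inner_diff_left inner_diff_right algebra_simps)
    then show ?thesis by (simp add: f_def)
  qed
  have "(LINT \<tau>|lborel. exp (\<i> * of_real (s \<bullet> (\<omega> - \<tau>)))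
        * (LINT h|lborel. exp (- \<i> * of_real (h \<bullet> (\<omega> - \<tau>))) * g h) * of_real (\<eta> \<tau>))
      = (LINT \<tau>|lborel. (LINT h|lborel. f \<tau> h))"
    unfolding e1 by (simp only: integral_mult_right_zero integral_mult_left_zero)
  also have "\<dots> = (LINT h|lborel. (LINT \<tau>|lborel. f \<tau> h))"
    by (rule lborel_pair.Fubini_integral[OF f_int, symmetric])
  also have "\<dots> = (LINT h|lborel. exp (\<i> * of_real (s \<bullet> \<omega>)) * (exp (- \<i> * of_real (h \<bullet> \<omega>)) * g h)
      * (LINT \<tau>|lborel. exp (\<i> * of_real ((h - s) \<bullet> \<tau>)) * of_real (\<eta> \<tau>)))"
    unfolding e2 by (simp only: integral_mult_right_zero)
  also have "\<dots> = (LINT h|lborel. exp (\<i> * of_real (s \<bullet> \<omega>)) * (exp (- \<i> * of_real (h \<bullet> \<omega>)) * g h))"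
  proof (rule integral_cong_AE)
    show "AE h in lborel. exp (\<i> * of_real (s \<bullet> \<omega>)) * (exp (- \<i> * of_real (h \<bullet> \<omega>)) * g h)
        * (LINT \<tau>|lborel. exp (\<i> * of_real ((h - s) \<bullet> \<tau>)) * of_real (\<eta> \<tau>))
      = exp (\<i> * of_real (s \<bullet> \<omega>)) * (exp (- \<i> * of_real (h \<bullet> \<omega>)) * g h)"
      using supp by eventually_elim (auto simp: one)
  qed measurable
  finally show ?thesis by simp
qed

lemma nn_integral_lborel_reflect:
  fixes f :: "'b::euclidean_space \<Rightarrow> ennreal"
  assumes [measurable]: "f \<in> borel_measurable borel"
  shows "(\<integral>\<^sup>+ \<tau>. f (\<omega> - \<tau>) \<partial>lborel) = (\<integral>\<^sup>+ \<tau>. f \<tau> \<partial>lborel)"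
proof -
  have "(lborel :: 'b measure) = density (distr lborel borel (\<lambda>x. \<omega> + (-1) *\<^sub>R x)) (\<lambda>_. ennreal (\<bar>-1::real\<bar> ^ DIM('b)))"
    by (rule lborel_affine) simp
  then have "(\<integral>\<^sup>+ \<tau>. f \<tau> \<partial>lborel) = (\<integral>\<^sup>+ \<tau>. f \<tau> \<partial>density (distr lborel borel (\<lambda>x. \<omega> + (-1) *\<^sub>R x)) (\<lambda>_. ennreal (\<bar>-1::real\<bar> ^ DIM('b))))"
    by simp
  also have "\<dots> = (\<integral>\<^sup>+ \<tau>. f (\<omega> - \<tau>) \<partial>lborel)"
    by (simp add: nn_integral_density nn_integral_distr)
  finally show ?thesis by simp
qed

text \<open>The reproducing formula is linear, and the same \<open>\<eta>\<close> serves every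
  \<open>s \<in> T\<close>, so \<open>F\<close> is its own convolution with \<open>\<eta>\<close>;
  Cauchy-Schwarz then bounds its values. Stating this in \<open>ennreal\<close> avoids having to
  know beforehand that \<open>F\<close> is square integrable.\<close>

lemma trig_poly_times_transform_bound:
  fixes g :: "'b::euclidean_space \<Rightarrow> complex" and \<eta> :: "'b \<Rightarrow> real" and a :: "'b \<Rightarrow> real"
  assumes g: "integrable lborel g" and \<eta>: "integrable lborel \<eta>"
    and one: "\<And>h. norm h \<le> R \<Longrightarrow> (LINT x|lborel. exp (\<i> * of_real (h \<bullet> x)) * of_real (\<eta> x)) = 1"
    and supp: "\<And>s. s \<in> T \<Longrightarrow> AE h in lborel. g h = 0 \<or> norm (h - s) \<le> R"
  defines "F \<equiv> \<lambda>\<omega>. trig_poly T a \<omega> * (LINT h|lborel. exp (- \<i> * of_real (h \<bullet> \<omega>)) * g h)"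
  shows "ennreal ((cmod (F \<omega>))\<^sup>2) \<le> (\<integral>\<^sup>+ \<tau>. ennreal ((cmod (F \<tau>))\<^sup>2) \<partial>lborel) * (\<integral>\<^sup>+ \<tau>. ennreal ((\<eta> \<tau>)\<^sup>2) \<partial>lborel)"
proof -
  have [measurable]: "g \<in> borel_measurable borel" "\<eta> \<in> borel_measurable borel" using g \<eta> by simp_all
  define G where "G \<omega> = (LINT h|lborel. exp (- \<i> * of_real (h \<bullet> \<omega>)) * g h)" for \<omega>
  have G_meas[measurable]: "G \<in> borel_measurable borel" unfolding G_def by measurable
  have F_eq: "F \<omega> = (\<Sum>s\<in>T. of_real (a s) * exp (\<i> * of_real (s \<bullet> \<omega>))) * G \<omega>" for \<omega>
    by (simp add: F_def G_def trig_poly_def)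
  have F_meas[measurable]: "F \<in> borel_measurable borel" unfolding F_eq by measurable
  have G_bound: "cmod (G \<omega>) \<le> (LINT h|lborel. cmod (g h))" for \<omega>
  proof -
    have "cmod (G \<omega>) \<le> (LINT h|lborel. cmod (exp (- \<i> * of_real (h \<bullet> \<omega>)) * g h))"
      unfolding G_def by (rule integral_norm_bound)
    then show ?thesis by (simp add: norm_mult)
  qed
  have term_int: "integrable lborel (\<lambda>\<tau>. exp (\<i> * of_real (s \<bullet> (\<omega> - \<tau>))) * G (\<omega> - \<tau>) * of_real (\<eta> \<tau>))" for s
    by (rule Bochner_Integration.integrable_bound[where f="\<lambda>\<tau>. (LINT h|lborel. cmod (g h)) * \<bar>\<eta> \<tau>\<bar>"])
      (use \<eta> in \<open>auto simp: norm_mult abs_mult intro!: AE_I2 mult_right_mono order_trans[OF G_bound]\<close>)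
  have sum_eq: "F (\<omega> - \<tau>) * of_real (\<eta> \<tau>)
      = (\<Sum>s\<in>T. of_real (a s) * (exp (\<i> * of_real (s \<bullet> (\<omega> - \<tau>))) * G (\<omega> - \<tau>) * of_real (\<eta> \<tau>)))" for \<tau>
    by (simp add: F_eq sum_distrib_right mult.assoc)
  have int: "integrable lborel (\<lambda>\<tau>. F (\<omega> - \<tau>) * of_real (\<eta> \<tau>))"
    unfolding sum_eq by (intro Bochner_Integration.integrable_sum integrable_mult_right term_int)
  have "F \<omega> = (\<Sum>s\<in>T. of_real (a s) * (exp (\<i> * of_real (s \<bullet> \<omega>)) * G \<omega>))"
    by (simp add: F_eq sum_distrib_right mult.assoc)
  also have "\<dots> = (\<Sum>s\<in>T. of_real (a s)
      * (LINT \<tau>|lborel. exp (\<i> * of_real (s \<bullet> (\<omega> - \<tau>))) * G (\<omega> - \<tau>) * of_real (\<eta> \<tau>)))"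
    unfolding G_def by (intro sum.cong refl arg_cong2[where f="(*)"] reproducing_formula[OF g \<eta> one supp])
  also have "\<dots> = (LINT \<tau>|lborel. F (\<omega> - \<tau>) * of_real (\<eta> \<tau>))"
    unfolding sum_eq by (subst Bochner_Integration.integral_sum) (auto intro!: term_int)
  finally have "ennreal (cmod (F \<omega>)) \<le> (\<integral>\<^sup>+ \<tau>. ennreal (cmod (F (\<omega> - \<tau>) * of_real (\<eta> \<tau>))) \<partial>lborel)"
    using integral_norm_bound_ennreal[OF int] by simp
  also have "\<dots> = (\<integral>\<^sup>+ \<tau>. ennreal (cmod (F (\<omega> - \<tau>))) * ennreal \<bar>\<eta> \<tau>\<bar> \<partial>lborel)"
    by (simp add: norm_mult ennreal_mult)
  finally have "(ennreal (cmod (F \<omega>)))\<^sup>2 \<le> (\<integral>\<^sup>+ \<tau>. ennreal (cmod (F (\<omega> - \<tau>))) * ennreal \<bar>\<eta> \<tau>\<bar> \<partial>lborel)\<^sup>2"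
    by (intro power_mono) auto
  also have "\<dots> \<le> (\<integral>\<^sup>+ \<tau>. (ennreal (cmod (F (\<omega> - \<tau>))))\<^sup>2 \<partial>lborel) * (\<integral>\<^sup>+ \<tau>. (ennreal \<bar>\<eta> \<tau>\<bar>)\<^sup>2 \<partial>lborel)"
    by (rule Cauchy_Schwarz_nn_integral) measurable
  also have "(\<integral>\<^sup>+ \<tau>. (ennreal (cmod (F (\<omega> - \<tau>))))\<^sup>2 \<partial>lborel) = (\<integral>\<^sup>+ \<tau>. (ennreal (cmod (F \<tau>)))\<^sup>2 \<partial>lborel)"
    by (rule nn_integral_lborel_reflect[where f="\<lambda>\<tau>. (ennreal (cmod (F \<tau>)))\<^sup>2"]) measurable
  finally show ?thesis by (simp add: ennreal_power)
qed

text \<open>Bridges the Lebesgue measurable \<open>g\<close> of the definitions and the Borel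
  setting in which Fubini is applied. Integrability comes from \<open>x \<le> 1 + x^2\<close> on a
  set of finite measure.\<close>

lemma L2_on_borel_version:
  fixes g :: "real ^ 'n \<Rightarrow> complex"
  assumes S: "bounded S" and L2: "L2_on S g" and zero: "\<And>h. h \<notin> S \<Longrightarrow> g h = 0"
  obtains g' where "integrable lborel g'" "AE h in lborel. g' h = 0 \<or> h \<in> S"
    "\<And>w. fourier_transform g w
      = complex_of_real (1 / (2 * pi) ^ CARD('n)) * (LINT h|lborel. exp (- \<i> * complex_of_real (h \<bullet> w)) * g' h)"
proof -
  have S_sets: "S \<in> sets lebesgue" using L2 by (simp add: L2_on_def)
  have fin: "finite_measure (lebesgue_on S)"
  proof
    have "emeasure lebesgue S < \<infinity>"
      using bounded_set_imp_lmeasurable[OF S S_sets] by (simp add: fmeasurable_def del: emeasure_completion)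
    then show "emeasure (lebesgue_on S) (space (lebesgue_on S)) \<noteq> \<infinity>"
      using S_sets by (simp add: emeasure_restrict_space space_restrict_space del: emeasure_completion)
  qed
  interpret finite_measure "lebesgue_on S" by (rule fin)
  have g_on: "integrable (lebesgue_on S) g"
  proof (rule Bochner_Integration.integrable_bound)
    show "integrable (lebesgue_on S) (\<lambda>h. 1 + (cmod (g h))\<^sup>2)"
      using L2 by (intro Bochner_Integration.integrable_add) (simp_all add: L2_on_def)
    have "x \<le> 1 + x\<^sup>2" for x :: real
      using sum_power2_ge_zero[of "x - 1/2" 0] by (simp add: power2_eq_square algebra_simps)
    then show "AE h in lebesgue_on S. norm (g h) \<le> norm (1 + (cmod (g h))\<^sup>2)"
      by (intro AE_I2) simp
  qed (use L2 in \<open>simp add: L2_on_def\<close>)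
  have g_int: "integrable lebesgue g"
  proof -
    have "integrable lebesgue (\<lambda>x. indicator S x *\<^sub>R g x)"
      using g_on S_sets by (simp add: integrable_restrict_space)
    also have "(\<lambda>x. indicator S x *\<^sub>R g x) = g"
      using zero by (auto simp: indicator_def)
    finally show ?thesis .
  qed
  have g_meas: "g \<in> borel_measurable lebesgue" using g_int by simp
  obtain gr where gr[measurable]: "gr \<in> borel_measurable lborel" "AE x in lborel. Re (g x) = gr x"
    using completion_ex_borel_measurable_real[of "\<lambda>x. Re (g x)" lborel] g_meas by auto
  obtain gi where gi[measurable]: "gi \<in> borel_measurable lborel" "AE x in lborel. Im (g x) = gi x"
    using completion_ex_borel_measurable_real[of "\<lambda>x. Im (g x)" lborel] g_meas by auto
  define g' where "g' x = Complex (gr x) (gi x)" for x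
  have g'_eq: "g' x = of_real (gr x) + \<i> * of_real (gi x)" for x
    by (simp add: g'_def complex_eq_iff)
  have g'_meas[measurable]: "g' \<in> borel_measurable lborel" unfolding g'_eq by measurable
  have ae: "AE x in lborel. g x = g' x"
    using gr(2) gi(2) by eventually_elim (simp add: g'_def complex_eq_iff)
  have ae': "AE x in lebesgue. g x = g' x" using ae by (rule AE_completion)
  have g'_meas': "g' \<in> borel_measurable lebesgue" by (rule measurable_completion) measurable
  have "integrable lebesgue g'"
    using integrable_cong_AE[OF g_meas g'_meas' ae'] g_int by simp
  then have g'_int: "integrable lborel g'" by (simp add: integrable_completion)
  have "AE h in lborel. g' h = 0 \<or> h \<in> S"
    using ae by eventually_elim (use zero in auto)
  moreover have "fourier_transform g w
      = complex_of_real (1 / (2 * pi) ^ CARD('n)) * (LINT h|lborel. exp (- \<i> * complex_of_real (h \<bullet> w)) * g' h)" for w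
  proof -
    have m: "(\<lambda>h. exp (- \<i> * complex_of_real (h \<bullet> w))) \<in> borel_measurable lebesgue"
      by (rule measurable_completion) measurable
    have "(LINT h|lebesgue. exp (- \<i> * complex_of_real (h \<bullet> w)) * g h)
        = (LINT h|lebesgue. exp (- \<i> * complex_of_real (h \<bullet> w)) * g' h)"
    proof (rule integral_cong_AE)
      show "AE h in lebesgue. exp (- \<i> * complex_of_real (h \<bullet> w)) * g h = exp (- \<i> * complex_of_real (h \<bullet> w)) * g' h"
        using ae' by eventually_elim simp
    qed (use m g_meas g'_meas' in \<open>auto intro!: borel_measurable_times\<close>)
    also have "\<dots> = (LINT h|lborel. exp (- \<i> * complex_of_real (h \<bullet> w)) * g' h)"
      by (rule integral_completion) measurable
    finally show ?thesis unfolding fourier_transform_def by simp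
  qed
  ultimately show thesis using that[OF g'_int] by blast
qed

text \<open>The lower comparison turns \<open>\<phi>^2\<close> into \<open>f\<close> under the
  integral, the upper one turns \<open>\<phi>^2\<close> into \<open>f\<close> at the point
  \<open>w\<close>. The resulting constant \<open>c2 / c1 * E\<close> knows the observation points
  only through the radius of \<open>Dstar\<close>; the normalisation \<open>k\<close> of the
  transform cancels.\<close>

lemma trig_poly_pointwise_bound:
  fixes D Dstar :: "(real ^ 'n) set" and f \<phi> :: "real ^ 'n \<Rightarrow> real"
  assumes bdd: "bounded Dstar" and sub: "D \<subseteq> Dstar"
    and FT: "fourier_transform_of_L2_supported_in Dstar \<phi>"
    and c1: "c1 > 0" and c2: "c2 > 0"
    and f: "\<And>w. c1 * (\<phi> w)\<^sup>2 \<le> f w \<and> f w \<le> c2 * (\<phi> w)\<^sup>2"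
    and f_int: "integrable lborel f"
  obtains C where "C \<ge> 0" "\<And>S a w. S \<subseteq> D \<Longrightarrow>
    (cmod (trig_poly S a w))\<^sup>2 * f w \<le> C * (LINT \<omega>|lborel. (cmod (trig_poly S a \<omega>))\<^sup>2 * f \<omega>)"
proof -
  obtain g where L2: "L2_on Dstar g" and zero: "\<And>h. h \<notin> Dstar \<Longrightarrow> g h = 0"
    and \<phi>: "\<And>w. complex_of_real (\<phi> w) = fourier_transform g w"
    using FT unfolding fourier_transform_of_L2_supported_in_def by blast
  define k where "k = 1 / (2 * pi) ^ CARD('n)"
  have k: "k > 0" by (simp add: k_def)
  obtain g' where g'_int: "integrable lborel g'" and g'_supp: "AE h in lborel. g' h = 0 \<or> h \<in> Dstar"
    and g'_ft: "\<And>w. fourier_transform g w = complex_of_real k * (LINT h|lborel. exp (- \<i> * complex_of_real (h \<bullet> w)) * g' h)"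
    by (rule L2_on_borel_version[OF bdd L2 zero, folded k_def]) (assumption | rule that)+
  obtain r where r: "r > 0" "\<And>x. x \<in> Dstar \<Longrightarrow> norm x \<le> r"
    using bdd unfolding bounded_pos by blast
  \<comment> \<open>The difference of two points of \<open>Dstar\<close> has norm at most
    \<open>2 * r\<close>, so this is the radius on which the transform of \<open>\<eta>\<close> has
    to be 1.\<close>
  have r2: "2 * r > 0" using r(1) by simp
  obtain \<eta> :: "real ^ 'n \<Rightarrow> real" where \<eta>: "integrable lborel \<eta>" "integrable lborel (\<lambda>x. (\<eta> x)\<^sup>2)"
    and one: "\<And>h. norm h \<le> 2 * r \<Longrightarrow> (LINT x|lborel. exp (\<i> * of_real (h \<bullet> x)) * of_real (\<eta> x)) = 1"
    by (rule trapezoid_kernel[OF r2]) (rule that)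
  define E where "E = (LINT \<tau>|lborel. (\<eta> \<tau>)\<^sup>2)"
  have E: "E \<ge> 0" unfolding E_def by (intro integral_nonneg_AE) simp
  have main: "(cmod (trig_poly S a w))\<^sup>2 * f w \<le> (c2 / c1 * E) * (LINT \<omega>|lborel. (cmod (trig_poly S a \<omega>))\<^sup>2 * f \<omega>)"
    if S: "S \<subseteq> D" for S a w
  proof -
    define I where "I = (LINT \<omega>|lborel. (cmod (trig_poly S a \<omega>))\<^sup>2 * f \<omega>)"
    define G where "G w = (LINT h|lborel. exp (- \<i> * complex_of_real (h \<bullet> w)) * g' h)" for w
    have G_sq: "(cmod (trig_poly S a w * G w))\<^sup>2 = (cmod (trig_poly S a w))\<^sup>2 * (\<phi> w)\<^sup>2 / k\<^sup>2" for w
    proof -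
      have "G w = complex_of_real (\<phi> w / k)" using \<phi>[of w] g'_ft[of w] k by (simp add: G_def)
      then have "cmod (G w) = \<bar>\<phi> w\<bar> / k" using k by (simp add: norm_divide)
      then show ?thesis by (simp add: norm_mult power_mult_distrib power_divide)
    qed
    have "AE h in lborel. g' h = 0 \<or> norm (h - s) \<le> 2 * r" if "s \<in> S" for s
      using g'_supp
    proof eventually_elim
      case (elim h)
      have "norm s \<le> r" using that S sub r(2) by auto
      then show ?case using elim r(2)[of h] norm_triangle_ineq4[of h s] by auto
    qed
    from trig_poly_times_transform_bound[OF g'_int \<eta>(1) one this, where \<omega>=w and a=a]
    have "ennreal ((cmod (trig_poly S a w * G w))\<^sup>2) \<le>
        (\<integral>\<^sup>+ \<tau>. ennreal ((cmod (trig_poly S a \<tau> * G \<tau>))\<^sup>2) \<partial>lborel) * (\<integral>\<^sup>+ \<tau>. ennreal ((\<eta> \<tau>)\<^sup>2) \<partial>lborel)"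
      unfolding G_def by blast
    also have "(\<integral>\<^sup>+ \<tau>. ennreal ((\<eta> \<tau>)\<^sup>2) \<partial>lborel) = ennreal E"
      unfolding E_def by (rule nn_integral_eq_integral[OF \<eta>(2)]) simp
    also have "(\<integral>\<^sup>+ \<tau>. ennreal ((cmod (trig_poly S a \<tau> * G \<tau>))\<^sup>2) \<partial>lborel)
        \<le> (\<integral>\<^sup>+ \<tau>. ennreal (1 / (c1 * k\<^sup>2) * ((cmod (trig_poly S a \<tau>))\<^sup>2 * f \<tau>)) \<partial>lborel)"
    proof (intro nn_integral_mono ennreal_leI)
      fix \<tau>
      have "c1 * ((cmod (trig_poly S a \<tau>))\<^sup>2 * (\<phi> \<tau>)\<^sup>2) \<le> (cmod (trig_poly S a \<tau>))\<^sup>2 * f \<tau>"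
        using mult_left_mono[OF conjunct1[OF f[of \<tau>]], of "(cmod (trig_poly S a \<tau>))\<^sup>2"] by (simp add: ac_simps)
      then show "(cmod (trig_poly S a \<tau> * G \<tau>))\<^sup>2 \<le> 1 / (c1 * k\<^sup>2) * ((cmod (trig_poly S a \<tau>))\<^sup>2 * f \<tau>)"
        unfolding G_sq using c1 k by (simp add: field_simps)
    qed
    also have "\<dots> = ennreal (1 / (c1 * k\<^sup>2) * I)"
    proof -
      have "0 \<le> f \<tau>" for \<tau>
        using f[of \<tau>] c1 by (meson mult_nonneg_nonneg order_trans less_imp_le zero_le_power2)
      then show ?thesis unfolding I_def integral_mult_right_zero[symmetric] using c1
        by (intro nn_integral_eq_integral integrable_mult_right integrable_trig_poly_square f_int AE_I2) simp
    qed
    finally have "ennreal ((cmod (trig_poly S a w * G w))\<^sup>2) \<le> ennreal (1 / (c1 * k\<^sup>2) * I) * ennreal E"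
      by (simp add: mult_right_mono)
    also have "\<dots> = ennreal (1 / (c1 * k\<^sup>2) * I * E)"
      using E by (rule ennreal_mult''[symmetric])
    finally have le: "ennreal ((cmod (trig_poly S a w * G w))\<^sup>2) \<le> ennreal (1 / (c1 * k\<^sup>2) * I * E)" .
    have I0: "I \<ge> 0"
    proof -
      have "0 \<le> f \<tau>" for \<tau>
        using f[of \<tau>] c1 by (meson mult_nonneg_nonneg order_trans less_imp_le zero_le_power2)
      then show ?thesis unfolding I_def by (intro integral_nonneg_AE AE_I2) simp
    qed
    then have "(cmod (trig_poly S a w))\<^sup>2 * (\<phi> w)\<^sup>2 / k\<^sup>2 \<le> 1 / (c1 * k\<^sup>2) * I * E"
      using le E c1 unfolding G_sq by (subst (asm) ennreal_le_iff) auto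
    then have "(cmod (trig_poly S a w))\<^sup>2 * (\<phi> w)\<^sup>2 \<le> I * E / c1"
      using k c1 by (simp add: field_simps)
    then have "c2 * ((cmod (trig_poly S a w))\<^sup>2 * (\<phi> w)\<^sup>2) \<le> c2 * (I * E / c1)"
      using c2 by (intro mult_left_mono) auto
    moreover have "(cmod (trig_poly S a w))\<^sup>2 * f w \<le> (cmod (trig_poly S a w))\<^sup>2 * (c2 * (\<phi> w)\<^sup>2)"
      using f[of w] by (intro mult_left_mono) auto
    ultimately show ?thesis unfolding I_def[symmetric] by (simp add: ac_simps)
  qed
  show thesis by (rule that[of "c2 / c1 * E"]) (use main c1 c2 E in auto)
qed

text \<open>Applying the pointwise bound to \<open>\<Sum>k. Re (u\<^sub>k w) u\<^sub>k\<close> and \<open>\<Sum>k. Im (u\<^sub>k w) u\<^sub>k\<close> for an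
  orthonormal family \<open>u\<close> bounds the diagonal of its reproducing kernel.\<close>

lemma trace_bound:
  fixes f fX :: "real ^ 'n \<Rightarrow> real" and a :: "nat \<Rightarrow> real ^ 'n \<Rightarrow> real"
  assumes C: "C \<ge> 0" "\<And>a w. (cmod (trig_poly S a w))\<^sup>2 * f w \<le> C * (LINT \<omega>|lborel. (cmod (trig_poly S a \<omega>))\<^sup>2 * f \<omega>)"
    and ortho: "\<And>p. (LINT \<omega>|lborel. (cmod (trig_poly S (\<lambda>s. \<Sum>k<m. p k * a k s) \<omega>))\<^sup>2 * f \<omega>) = (\<Sum>k<m. (p k)\<^sup>2)"
    and f: "\<And>w. f w > 0" and fX: "\<And>w. fX w \<ge> 0" and fX_int: "integrable lborel fX"
    and ratio: "integrable lborel (\<lambda>w. fX w / f w)"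
  shows "(\<Sum>k<m. (LINT \<omega>|lborel. (cmod (trig_poly S (a k) \<omega>))\<^sup>2 * fX \<omega>)) \<le> 2 * C * (LINT \<omega>|lborel. fX \<omega> / f \<omega>)"
proof -
  have comb: "trig_poly S (\<lambda>s. \<Sum>k<m. p k * a k s) w = (\<Sum>k<m. of_real (p k) * trig_poly S (a k) w)" for p w
    unfolding trig_poly_def by (simp add: sum_distrib_left sum_distrib_right mult.assoc) (rule sum.swap)
  \<comment> \<open>With \<open>s\<close> for the sum of the squares \<open>(p k)^2\<close>, the
    pointwise bound and orthonormality give \<open>s^2 * f w \<le> C * s\<close>; cancelling one
    factor \<open>s\<close> is the whole argument.\<close>
  have key: "(\<Sum>k<m. (p k)\<^sup>2) * f w \<le> C"
    if "(\<Sum>k<m. (p k)\<^sup>2) \<le> cmod (\<Sum>k<m. of_real (p k) * trig_poly S (a k) w)" for p w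
  proof (cases "(\<Sum>k<m. (p k)\<^sup>2) = 0")
    case True
    then show ?thesis using C(1) by simp
  next
    case False
    let ?s = "\<Sum>k<m. (p k)\<^sup>2"
    have s: "?s > 0" using False by (simp add: order_less_le sum_nonneg)
    have "?s\<^sup>2 * f w \<le> (cmod (\<Sum>k<m. of_real (p k) * trig_poly S (a k) w))\<^sup>2 * f w"
      using that s f[of w] by (intro mult_right_mono power_mono) auto
    also have "\<dots> \<le> C * ?s"
      using C(2)[of "\<lambda>s. \<Sum>k<m. p k * a k s" w] ortho[of p] by (simp only: comb)
    finally have "(?s * f w) * ?s \<le> C * ?s" by (simp only: power2_eq_square ac_simps)
    then show ?thesis using s by (rule mult_right_le_imp_le)
  qed
  \<comment> \<open>The coefficients \<open>p\<close> have to be real, so real and imaginary parts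
    are treated separately, which costs the factor 2.\<close>
  have diag: "(\<Sum>k<m. (cmod (trig_poly S (a k) w))\<^sup>2) * f w \<le> 2 * C" for w
  proof -
    let ?z = "\<lambda>k. trig_poly S (a k) w"
    have "(\<Sum>k<m. (Re (?z k))\<^sup>2) * f w \<le> C"
      by (rule key, rule order_trans[OF _ complex_Re_le_cmod]) (simp add: power2_eq_square)
    moreover have "(\<Sum>k<m. (Im (?z k))\<^sup>2) * f w \<le> C"
      by (rule key, rule order_trans[OF _ order_trans[OF abs_ge_self abs_Im_le_cmod]]) (simp add: power2_eq_square)
    ultimately show ?thesis by (simp add: cmod_power2 sum.distrib distrib_right)
  qed
  have "(\<Sum>k<m. (LINT \<omega>|lborel. (cmod (trig_poly S (a k) \<omega>))\<^sup>2 * fX \<omega>))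
      = (LINT \<omega>|lborel. (\<Sum>k<m. (cmod (trig_poly S (a k) \<omega>))\<^sup>2 * fX \<omega>))"
    by (rule Bochner_Integration.integral_sum[symmetric]) (intro integrable_trig_poly_square fX_int)
  also have "\<dots> \<le> (LINT \<omega>|lborel. 2 * C * (fX \<omega> / f \<omega>))"
  proof (rule integral_mono)
    fix w
    have "(\<Sum>k<m. (cmod (trig_poly S (a k) w))\<^sup>2 * fX w) = ((\<Sum>k<m. (cmod (trig_poly S (a k) w))\<^sup>2) * f w) * (fX w / f w)"
      using f[of w] by (simp add: sum_distrib_right[symmetric])
    also have "\<dots> \<le> 2 * C * (fX w / f w)"
      using f[of w] fX[of w] by (intro mult_right_mono diag) simp
    finally show "(\<Sum>k<m. (cmod (trig_poly S (a k) w))\<^sup>2 * fX w) \<le> 2 * C * (fX w / f w)" .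
  qed (intro Bochner_Integration.integrable_sum integrable_trig_poly_square fX_int integrable_mult_right ratio)+
  finally show ?thesis by (simp only: integral_mult_right_zero)
qed

section \<open>Joint laws from characteristic functions\<close>

text \<open>Taking \<open>s = 0\<close> shows that \<open>m\<close> is the mean of \<open>h\<close>.
  If \<open>m > 0\<close>, reweighting by \<open>h / m\<close> leaves the characteristic function of
  \<open>V\<close> unchanged, hence also its law; if \<open>m = 0\<close>, the tilt vanishes almost
  everywhere. In this way a factorisation known for exponentials of \<open>V\<close> is carried over
  to indicators.\<close>

lemma (in prob_space) char_tilted_real:
  fixes V h :: "'a \<Rightarrow> real" and m B :: real
  assumes V[measurable]: "V \<in> borel_measurable M" and h[measurable]: "h \<in> borel_measurable M"
    and bnd: "\<And>x. 0 \<le> h x" "\<And>x. h x \<le> B"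
    and ch: "\<And>s. (LINT x|M. of_real (h x) * exp (\<i> * of_real (s * V x))) = of_real m * char (distr M borel V) s"
    and A: "A \<in> sets borel"
  shows "(LINT x|M. h x * indicator A (V x)) = m * measure (distr M borel V) A"
proof -
  let ?N = "distr M borel V"
  interpret N: real_distribution ?N
    by (simp add: real_distribution_def real_distribution_axioms_def prob_space_distr)
  have h_int: "integrable M h"
    by (rule integrable_const_bound[where B=B]) (use bnd in auto)
  have hA_int: "integrable M (\<lambda>x. h x * indicator A (V x))"
    by (rule Bochner_Integration.integrable_bound[OF h_int]) (use A in \<open>auto simp: indicator_def\<close>)
  have "complex_of_real (LINT x|M. h x) = of_real m"
    using ch[of 0] N.char_zero by simp
  then have m: "(LINT x|M. h x) = m" using of_real_eq_iff by blast
  have m0: "m \<ge> 0" unfolding m[symmetric] using bnd by simp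
  show ?thesis
  proof (cases "m = 0")
    case True
    then have "AE x in M. h x = 0"
      using m integral_nonneg_eq_0_iff_AE[OF h_int] bnd by auto
    then have "(LINT x|M. h x * indicator A (V x)) = (LINT x|M. 0)"
      using A by (intro integral_cong_AE) auto
    then show ?thesis using True by simp
  next
    case False
    then have mpos: "m > 0" using m0 by simp
    let ?Q = "density M (\<lambda>x. ennreal (h x / m))"
    have Q_meas: "V \<in> borel_measurable ?Q" by simp
    have "(\<integral>\<^sup>+x. ennreal (h x / m) \<partial>M) = ennreal (LINT x|M. h x / m)"
      using h_int bnd mpos by (intro nn_integral_eq_integral) auto
    then have "emeasure ?Q (space ?Q) = 1"
      using m mpos by (simp add: emeasure_density)
    then interpret Q: prob_space ?Q by (rule prob_spaceI)
    have "real_distribution (distr ?Q borel V)"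
      by (simp add: real_distribution_def real_distribution_axioms_def Q.prob_space_distr)
    moreover have "char (distr ?Q borel V) = char ?N"
    proof
      fix s
      have "char (distr ?Q borel V) s = (LINT x|?Q. exp (\<i> * of_real (s * V x)))"
        unfolding char_def by (rule integral_distr) measurable
      also have "\<dots> = (LINT x|M. (h x / m) *\<^sub>R exp (\<i> * of_real (s * V x)))"
        by (rule integral_density) (use bnd mpos in auto)
      also have "\<dots> = (LINT x|M. of_real (1 / m) * (of_real (h x) * exp (\<i> * of_real (s * V x))))"
        by (simp add: scaleR_conv_of_real)
      also have "\<dots> = char ?N s"
        using mpos unfolding integral_mult_right_zero ch by (simp add: divide_simps)
      finally show "char (distr ?Q borel V) s = char ?N s" .
    qed
    ultimately have "distr ?Q borel V = ?N"
      using Levy_uniqueness N.real_distribution_axioms by blast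
    then have "measure ?N A = measure (distr ?Q borel V) A" by simp
    also have "\<dots> = (LINT x|?Q. indicator A (V x))"
      using integral_distr[of V ?Q borel "indicator A :: real \<Rightarrow> real"] A by simp
    also have "\<dots> = (LINT x|M. (h x / m) *\<^sub>R indicator A (V x))"
      by (rule integral_density) (use bnd mpos A in auto)
    also have "\<dots> = (LINT x|M. (1 / m) * (h x * indicator A (V x)))" by simp
    also have "\<dots> = (LINT x|M. h x * indicator A (V x)) / m"
      by (simp only: integral_mult_right_zero) simp
    finally show ?thesis using mpos by simp
  qed
qed

text \<open>Reduced to a nonnegative tilt, to which Levy's uniqueness theorem applies, by passing to
  \<open>1 + Re G\<close> and \<open>1 + Im G\<close>.\<close>

lemma (in prob_space) char_tilted:
  fixes V :: "'a \<Rightarrow> real" and G :: "'a \<Rightarrow> complex"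
  assumes V[measurable]: "V \<in> borel_measurable M" and G[measurable]: "G \<in> borel_measurable M"
    and bnd: "\<And>x. cmod (G x) \<le> 1"
    and ch: "\<And>s. (LINT x|M. G x * exp (\<i> * of_real (s * V x))) = z * char (distr M borel V) s"
    and A: "A \<in> sets borel"
  shows "(LINT x|M. G x * of_real (indicator A (V x))) = z * of_real (measure (distr M borel V) A)"
proof -
  let ?N = "distr M borel V"
  have int[simp]: "integrable M H" if "H \<in> borel_measurable M" "\<And>x. cmod (H x) \<le> 1" for H :: "'a \<Rightarrow> complex"
    by (rule integrable_const_bound[where B=1]) (use that in auto)
  have real_part: "(LINT x|M. Re (H x) * indicator A (V x)) = Re w * measure ?N A"
    if H[measurable]: "H \<in> borel_measurable M" and Hb: "\<And>x. cmod (H x) \<le> 1"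
      and Hch: "\<And>s. (LINT x|M. H x * exp (\<i> * of_real (s * V x))) = w * char ?N s" for H w
  proof -
    have "\<bar>Re (H x)\<bar> \<le> 1" for x using Hb[of x] abs_Re_le_cmod[of "H x"] by linarith
    then have b: "0 \<le> 1 + Re (H x)" "1 + Re (H x) \<le> 2" for x by (smt (verit))+
    have "(LINT x|M. of_real (1 + Re (H x)) * exp (\<i> * of_real (s * V x))) = of_real (1 + Re w) * char ?N s" for s
    proof -
      have [measurable]: "(\<lambda>x. cnj (H x)) \<in> borel_measurable M"
        by (intro borel_measurable_continuous_on[OF _ H] continuous_intros)
      have one: "(LINT x|M. exp (\<i> * of_real (s * V x))) = char ?N s" for s
        unfolding char_def by (rule integral_distr[symmetric]) measurable
      have cnj_char: "cnj (char ?N (- s)) = char ?N s"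
      proof -
        have "cnj (char ?N (- s)) = (LINT x|M. cnj (exp (\<i> * of_real (- s * V x))))"
          unfolding one[symmetric] by (rule Bochner_Integration.integral_cnj[symmetric])
        also have "(\<lambda>x. cnj (exp (\<i> * of_real (- s * V x)))) = (\<lambda>x. exp (\<i> * of_real (s * V x)))"
          by (simp add: exp_cnj)
        finally show ?thesis by (simp only: one)
      qed
      \<comment> \<open>Conjugating the hypothesis at \<open>- s\<close> gives the same identity for
        the conjugate of \<open>H\<close> with \<open>cnj w\<close>; averaging the two yields the
        one for the real part.\<close>
      have "(LINT x|M. cnj (H x) * exp (\<i> * of_real (s * V x)))
          = cnj (LINT x|M. H x * exp (\<i> * of_real (- s * V x)))"
        unfolding Bochner_Integration.integral_cnj[symmetric] by (simp add: exp_cnj)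
      also have "\<dots> = cnj w * char ?N s" unfolding Hch by (simp add: cnj_char)
      finally have c: "(LINT x|M. cnj (H x) * exp (\<i> * of_real (s * V x))) = cnj w * char ?N s" .
      have eq: "of_real (1 + Re (H x)) * exp (\<i> * of_real (s * V x))
          = exp (\<i> * of_real (s * V x)) + (1/2) * (H x * exp (\<i> * of_real (s * V x)))
            + (1/2) * (cnj (H x) * exp (\<i> * of_real (s * V x)))" for x
      proof -
        have "complex_of_real (1 + Re (H x)) = 1 + (1/2) * H x + (1/2) * cnj (H x)"
          by (simp add: complex_eq_iff)
        then show ?thesis by (simp add: algebra_simps)
      qed
      have "(LINT x|M. of_real (1 + Re (H x)) * exp (\<i> * of_real (s * V x)))
          = char ?N s + (1/2) * (w * char ?N s) + (1/2) * (cnj w * char ?N s)"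
        unfolding eq
        by (subst Bochner_Integration.integral_add, (intro Bochner_Integration.integrable_add integrable_mult_right int; simp add: norm_mult Hb)+,
            subst Bochner_Integration.integral_add, (intro integrable_mult_right int; simp add: norm_mult Hb)+,
            simp only: integral_mult_right_zero one Hch c)
      also have "\<dots> = (1 + (1/2) * (w + cnj w)) * char ?N s" by (simp add: algebra_simps)
      also have "1 + (1/2) * (w + cnj w) = of_real (1 + Re w)" by (simp add: complex_eq_iff)
      finally show ?thesis .
    qed
    from char_tilted_real[OF V _ b this A]
    have "(LINT x|M. (1 + Re (H x)) * indicator A (V x)) = (1 + Re w) * measure ?N A" by simp
    moreover have "(LINT x|M. (1 + Re (H x)) * indicator A (V x))
        = (LINT x|M. indicator A (V x)) + (LINT x|M. Re (H x) * indicator A (V x))"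
    proof -
      have "integrable M (\<lambda>x. indicator A (V x) :: real)"
        by (rule integrable_const_bound[where B=1]) (use A in \<open>auto simp: indicator_def\<close>)
      moreover have "integrable M (\<lambda>x. Re (H x) * indicator A (V x))"
        by (rule integrable_const_bound[where B=1])
          (use A \<open>\<And>x. \<bar>Re (H x)\<bar> \<le> 1\<close> in \<open>auto simp: indicator_def\<close>)
      ultimately show ?thesis by (simp add: distrib_right)
    qed
    moreover have "(LINT x|M. indicator A (V x)) = measure ?N A"
      using integral_distr[of V M borel "indicator A :: real \<Rightarrow> real"] A by simp
    ultimately show ?thesis by (simp add: distrib_right)
  qed
  have re: "(LINT x|M. Re (G x) * indicator A (V x)) = Re z * measure ?N A"
    by (rule real_part) (use bnd ch in auto)
  \<comment> \<open>The imaginary part of \<open>G\<close> is the real part of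
    \<open>- \<i> * G\<close>, so the same argument applies.\<close>
  have im: "(LINT x|M. Re (- \<i> * G x) * indicator A (V x)) = Re (- \<i> * z) * measure ?N A"
  proof (rule real_part)
    show "(LINT x|M. - \<i> * G x * exp (\<i> * of_real (s * V x))) = - \<i> * z * char ?N s" for s
      unfolding mult.assoc integral_mult_right_zero ch ..
  qed (use bnd in \<open>auto simp: norm_mult\<close>)
  have i: "integrable M (\<lambda>x. G x * of_real (indicator A (V x)))"
    by (rule int) (use bnd A in \<open>auto simp: norm_mult indicator_def\<close>)
  show ?thesis
  proof (rule complex_eqI)
    show "Re (LINT x|M. G x * of_real (indicator A (V x))) = Re (z * of_real (measure ?N A))"
      using re i by (simp flip: integral_Re)
    show "Im (LINT x|M. G x * of_real (indicator A (V x))) = Im (z * of_real (measure ?N A))"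
      using im i by (simp flip: integral_Im)
  qed
qed

text \<open>Exponentials are exchanged for indicators one coordinate at a time. The indicators
  already obtained for \<open>J\<close>, together with the exponentials still to be treated, form a
  bounded tilt for the next coordinate, so uniqueness is only ever applied to laws on the
  line.\<close>

lemma (in prob_space) prob_prod_of_char_prod:
  fixes V :: "'i \<Rightarrow> 'a \<Rightarrow> real"
  assumes I: "finite I" and V[measurable]: "\<And>i. i \<in> I \<Longrightarrow> V i \<in> borel_measurable M"
    and ch: "\<And>t. (LINT x|M. exp (\<i> * of_real (\<Sum>i\<in>I. t i * V i x))) = (\<Prod>i\<in>I. char (distr M borel (V i)) (t i))"
    and A: "\<And>i. i \<in> I \<Longrightarrow> A i \<in> sets borel"
  shows "prob {x\<in>space M. \<forall>i\<in>I. V i x \<in> A i} = (\<Prod>i\<in>I. measure (distr M borel (V i)) (A i))"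
proof -
  let ?c = "\<lambda>i. char (distr M borel (V i))" and ?\<mu> = "\<lambda>i. measure (distr M borel (V i)) (A i)"
  have "(LINT x|M. (\<Prod>i\<in>J. of_real (indicator (A i) (V i x))) * exp (\<i> * of_real (\<Sum>i\<in>I - J. t i * V i x)))
      = (\<Prod>i\<in>J. of_real (?\<mu> i)) * (\<Prod>i\<in>I - J. ?c i (t i))"
    if "J \<subseteq> I" for J t
    using finite_subset[OF that I] that
  proof (induction J arbitrary: t rule: finite_induct)
    case empty
    then show ?case using ch by simp
  next
    case (insert j J)
    have j: "j \<in> I - J" and JI: "J \<subseteq> I" using insert by auto
    have D: "I - J = insert j (I - insert j J)" "j \<notin> I - insert j J" using j by auto
    have fin: "finite (I - insert j J)" using I by simp
    let ?G = "\<lambda>x. (\<Prod>i\<in>J. of_real (indicator (A i) (V i x))) * exp (\<i> * of_real (\<Sum>i\<in>I - insert j J. t i * V i x)) :: complex"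
    have [measurable]: "i \<in> J \<Longrightarrow> V i \<in> borel_measurable M" "i \<in> J \<Longrightarrow> A i \<in> sets borel" for i
      using JI V A by auto
    have [measurable]: "i \<in> I - insert j J \<Longrightarrow> V i \<in> borel_measurable M" for i using V by auto
    have "(LINT x|M. ?G x * of_real (indicator (A j) (V j x)))
        = ((\<Prod>i\<in>J. of_real (?\<mu> i)) * (\<Prod>i\<in>I - insert j J. ?c i (t i))) * of_real (?\<mu> j)"
    proof (rule char_tilted)
      show "V j \<in> borel_measurable M" "A j \<in> sets borel" using j V A by auto
      show "?G \<in> borel_measurable M" by measurable
      have "(\<Prod>i\<in>J. cmod (of_real (indicator (A i) (V i x)))) \<le> 1" for x
        by (intro prod_le_1) (auto simp: indicator_def)
      then show "cmod (?G x) \<le> 1" for x by (simp add: norm_mult prod_norm[symmetric])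
      fix s
      have "?G x * exp (\<i> * of_real (s * V j x))
          = (\<Prod>i\<in>J. of_real (indicator (A i) (V i x))) * exp (\<i> * of_real (\<Sum>i\<in>I - J. (t(j := s)) i * V i x))" for x
      proof -
        have "(\<Sum>i\<in>I - J. (t(j := s)) i * V i x) = s * V j x + (\<Sum>i\<in>I - insert j J. (t(j := s)) i * V i x)"
          unfolding D(1) by (subst sum.insert[OF fin D(2)]) simp
        also have "(\<Sum>i\<in>I - insert j J. (t(j := s)) i * V i x) = (\<Sum>i\<in>I - insert j J. t i * V i x)"
          by (intro sum.cong) auto
        finally show ?thesis by (simp add: distrib_left exp_add)
      qed
      then have "(LINT x|M. ?G x * exp (\<i> * of_real (s * V j x)))
          = (\<Prod>i\<in>J. of_real (?\<mu> i)) * (\<Prod>i\<in>I - J. ?c i ((t(j := s)) i))"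
        using insert.IH[OF JI] by (simp only:)
      also have "(\<Prod>i\<in>I - J. ?c i ((t(j := s)) i)) = ?c j s * (\<Prod>i\<in>I - insert j J. ?c i ((t(j := s)) i))"
        unfolding D(1) by (subst prod.insert[OF fin D(2)]) simp
      also have "(\<Prod>i\<in>I - insert j J. ?c i ((t(j := s)) i)) = (\<Prod>i\<in>I - insert j J. ?c i (t i))"
        by (intro prod.cong) auto
      finally show "(LINT x|M. ?G x * exp (\<i> * of_real (s * V j x)))
          = (\<Prod>i\<in>J. of_real (?\<mu> i)) * (\<Prod>i\<in>I - insert j J. ?c i (t i)) * ?c j s"
        by (simp only: ac_simps)
    qed
    then show ?case by (simp only: prod.insert[OF insert.hyps] ac_simps)
  qed
  \<comment> \<open>At \<open>J = I\<close> no exponential is left, so any value of \<open>t\<close>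
    will do.\<close>
  from this[of I undefined]
  have "(LINT x|M. (\<Prod>i\<in>I. complex_of_real (indicator (A i) (V i x)))) = of_real (\<Prod>i\<in>I. ?\<mu> i)"
    by simp
  also have "(\<lambda>x. \<Prod>i\<in>I. complex_of_real (indicator (A i) (V i x)))
      = (\<lambda>x. complex_of_real (indicator {x. \<forall>i\<in>I. V i x \<in> A i} x))"
    using I by (auto simp: fun_eq_iff indicator_def prod_zero_iff)
  finally have "(LINT x|M. indicator {x. \<forall>i\<in>I. V i x \<in> A i} x) = (\<Prod>i\<in>I. ?\<mu> i)"
    unfolding integral_complex_of_real of_real_eq_iff .
  moreover have "{x\<in>space M. \<forall>i\<in>I. V i x \<in> A i} = {x. \<forall>i\<in>I. V i x \<in> A i} \<inter> space M" by auto
  ultimately show ?thesis by simp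
qed

section \<open>Gaussian vectors and their shifts\<close>

lemma (in prob_space) gaussian_rv_integrable:
  assumes "gaussian_rv M Z"
  shows "integrable M Z" "integrable M (\<lambda>x. (Z x)\<^sup>2)"
proof -
  have [measurable]: "Z \<in> borel_measurable M" using assms by (simp add: gaussian_rv_def)
  from assms obtain \<mu> \<sigma> where
    "(\<sigma> > 0 \<and> distributed M lborel Z (\<lambda>z. ennreal (normal_density \<mu> \<sigma> z))) \<or> (\<sigma> = 0 \<and> (AE x in M. Z x = \<mu>))"
    unfolding gaussian_rv_def by blast
  then have "integrable M Z \<and> integrable M (\<lambda>x. (Z x)\<^sup>2)"
  proof (elim disjE conjE)
    assume \<sigma>: "\<sigma> > 0" and D: "distributed M lborel Z (\<lambda>z. ennreal (normal_density \<mu> \<sigma> z))"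
    have "integrable lborel (\<lambda>z. normal_density \<mu> \<sigma> z * z)"
      using integrable_normal_moment_nz_1[OF \<sigma>] .
    then have 1: "integrable M Z"
      using distributed_integrable[OF D, of "\<lambda>z. z"] by simp
    have "integrable lborel (\<lambda>z. normal_density \<mu> \<sigma> z * (z - \<mu>)\<^sup>2)"
      using integrable_normal_moment[OF \<sigma>] .
    then have 2: "integrable M (\<lambda>x. (Z x - \<mu>)\<^sup>2)"
      using distributed_integrable[OF D, of "\<lambda>z. (z - \<mu>)\<^sup>2"] by simp
    have "(\<lambda>x. (Z x)\<^sup>2) = (\<lambda>x. (Z x - \<mu>)\<^sup>2 + 2 * \<mu> * Z x - \<mu>\<^sup>2)"
      by (simp add: fun_eq_iff power2_eq_square algebra_simps)
    then show ?thesis using 1 2 by simp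
  next
    assume ae: "AE x in M. Z x = \<mu>"
    have "integrable M (\<lambda>x. (Z x)\<^sup>2) \<longleftrightarrow> integrable M (\<lambda>x. \<mu>\<^sup>2)"
      by (rule integrable_cong_AE) (use ae in auto)
    moreover have "integrable M Z \<longleftrightarrow> integrable M (\<lambda>x. \<mu>)"
      by (rule integrable_cong_AE) (use ae in auto)
    ultimately show ?thesis by simp
  qed
  then show "integrable M Z" "integrable M (\<lambda>x. (Z x)\<^sup>2)" by auto
qed

lemma (in prob_space) gaussian_rv_integrable_mult:
  assumes "gaussian_rv M f" "gaussian_rv M g"
  shows "integrable M (\<lambda>x. f x * g x)"
proof (rule Bochner_Integration.integrable_bound)
  show "integrable M (\<lambda>x. (f x)\<^sup>2 + (g x)\<^sup>2)" using assms gaussian_rv_integrable(2) by auto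
  show "(\<lambda>x. f x * g x) \<in> borel_measurable M" using assms by (auto simp: gaussian_rv_def)
  have "\<bar>u * w\<bar> \<le> u\<^sup>2 + w\<^sup>2" for u w :: real
    using sum_squares_bound[of "\<bar>u\<bar>" "\<bar>w\<bar>"] mult_nonneg_nonneg[OF abs_ge_zero[of u] abs_ge_zero[of w]]
    unfolding abs_mult power2_abs by linarith
  then show "AE x in M. norm (f x * g x) \<le> norm ((f x)\<^sup>2 + (g x)\<^sup>2)" by (intro AE_I2) simp
qed

lemma gaussian_field_rv: "gaussian_field M Z \<Longrightarrow> gaussian_rv M (Z s)"
  unfolding gaussian_field_def by (elim allE[of _ "{s}"] allE[of _ "\<lambda>_. 1"]) simp

text \<open>A point mass of mean 0 fits the same formula with variance 0, so degenerate
  combinations, such as the one with all coefficients 0, need no separate treatment later.\<close>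

lemma (in prob_space) gaussian_rv_char:
  assumes G: "gaussian_rv M Z" and mean: "(LINT x|M. Z x) = 0"
  shows "(LINT x|M. exp (\<i> * of_real (Z x))) = of_real (exp (- (LINT x|M. (Z x)\<^sup>2) / 2))"
proof -
  have [measurable]: "Z \<in> borel_measurable M" using G by (simp add: gaussian_rv_def)
  from G obtain \<mu> \<sigma> where
    "(\<sigma> > 0 \<and> distributed M lborel Z (\<lambda>z. ennreal (normal_density \<mu> \<sigma> z))) \<or> (\<sigma> = 0 \<and> (AE x in M. Z x = \<mu>))"
    unfolding gaussian_rv_def by blast
  then show ?thesis
  proof (elim disjE conjE)
    assume \<sigma>: "\<sigma> > 0" and D: "distributed M lborel Z (\<lambda>z. ennreal (normal_density \<mu> \<sigma> z))"
    have \<mu>: "\<mu> = 0" using normal_distributed_expectation[OF \<sigma> D] mean by simp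
    have v: "(LINT x|M. (Z x)\<^sup>2) = \<sigma>\<^sup>2"
      using normal_distributed_variance[OF \<sigma> D] mean by simp
    have S: "distributed M lborel (\<lambda>x. Z x / \<sigma>) (\<lambda>z. ennreal (std_normal_density z))"
      using D \<sigma> normal_standard_normal_convert[of \<sigma> Z 0] \<mu> by simp
    have "distr M borel (\<lambda>x. Z x / \<sigma>) = distr M lborel (\<lambda>x. Z x / \<sigma>)"
      by (rule distr_cong) auto
    also have "\<dots> = std_normal_distribution"
      using S by (simp add: distributed_def)
    finally have law: "distr M borel (\<lambda>x. Z x / \<sigma>) = std_normal_distribution" .
    have "(LINT x|M. exp (\<i> * of_real (Z x))) = (LINT x|M. exp (\<i> * of_real (\<sigma> * (Z x / \<sigma>))))"
      using \<sigma> by simp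
    also have "\<dots> = char (distr M borel (\<lambda>x. Z x / \<sigma>)) \<sigma>"
      unfolding char_def by (rule integral_distr[symmetric]) measurable
    also have "\<dots> = of_real (exp (- \<sigma>\<^sup>2 / 2))"
      unfolding law by (simp add: char_std_normal_distribution)
    finally show ?thesis by (simp add: v)
  next
    assume ae: "AE x in M. Z x = \<mu>"
    have "(LINT x|M. Z x) = (LINT x|M. \<mu>)"
      by (rule integral_cong_AE) (use ae in auto)
    then have \<mu>: "\<mu> = 0" using mean by (simp add: prob_space)
    have "(LINT x|M. (Z x)\<^sup>2) = (LINT x|M. 0)"
      by (rule integral_cong_AE) (use ae \<mu> in auto)
    moreover have "(LINT x|M. exp (\<i> * of_real (Z x))) = (LINT x|M. 1)"
      by (rule integral_cong_AE) (use ae \<mu> in auto)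
    ultimately show ?thesis by (simp add: prob_space)
  qed
qed

text \<open>The variance \<open>\<Sum>i\<in>I. (t i)^2\<close> makes the joint characteristic
  function a product of standard normal ones, and the factorisation passes to probabilities of
  boxes.\<close>

lemma (in prob_space) orthonormal_gaussian_law:
  fixes V :: "'i \<Rightarrow> 'a \<Rightarrow> real"
  assumes I: "finite I" and V[measurable]: "\<And>i. i \<in> I \<Longrightarrow> V i \<in> borel_measurable M"
    and G: "\<And>t. gaussian_rv M (\<lambda>x. \<Sum>i\<in>I. t i * V i x)"
    and mean: "\<And>t. (LINT x|M. (\<Sum>i\<in>I. t i * V i x)) = 0"
    and var: "\<And>t. (LINT x|M. (\<Sum>i\<in>I. t i * V i x)\<^sup>2) = (\<Sum>i\<in>I. (t i)\<^sup>2)"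
  shows "distr M (Pi\<^sub>M I (\<lambda>_. borel)) (\<lambda>x. \<lambda>i\<in>I. V i x) = Pi\<^sub>M I (\<lambda>_. std_normal_distribution)"
proof -
  interpret product_sigma_finite "\<lambda>_::'i. std_normal_distribution"
    using real_dist_normal_dist by (simp add: product_sigma_finite_def real_distribution_def prob_space_imp_sigma_finite)
  have ch: "(LINT x|M. exp (\<i> * of_real (\<Sum>i\<in>I. t i * V i x))) = of_real (exp (- (\<Sum>i\<in>I. (t i)\<^sup>2) / 2))" for t
    using gaussian_rv_char[OF G mean] unfolding var .
  have law: "distr M borel (V i) = std_normal_distribution" if i: "i \<in> I" for i
  proof (rule Levy_uniqueness[OF _ real_dist_normal_dist])
    show "real_distribution (distr M borel (V i))"
      using i by (simp add: real_distribution_def real_distribution_axioms_def prob_space_distr)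
    show "char (distr M borel (V i)) = char std_normal_distribution"
    proof
      fix s
      have s1: "(\<Sum>j\<in>I. (if j = i then s else 0) * V j x) = s * V i x" for x
        using I i by (simp add: if_distrib[where f="\<lambda>c. c * _"] cong: if_cong)
      have s2: "(\<Sum>j\<in>I. ((if j = i then s else 0))\<^sup>2) = s\<^sup>2"
        using I i by (simp add: if_distrib[where f="\<lambda>c. c\<^sup>2"] cong: if_cong)
      have "char (distr M borel (V i)) s = (LINT x|M. exp (\<i> * of_real (s * V i x)))"
        unfolding char_def using i by (intro integral_distr) auto
      also have "\<dots> = of_real (exp (- s\<^sup>2 / 2))"
        using ch[of "\<lambda>j. if j = i then s else 0"] unfolding s1 s2 .
      finally show "char (distr M borel (V i)) s = char std_normal_distribution s"
        by (simp add: char_std_normal_distribution)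
    qed
  qed
  have ch': "(LINT x|M. exp (\<i> * of_real (\<Sum>i\<in>I. t i * V i x))) = (\<Prod>i\<in>I. char (distr M borel (V i)) (t i))" for t
  proof -
    have "(\<Prod>i\<in>I. char (distr M borel (V i)) (t i)) = (\<Prod>i\<in>I. of_real (exp (- (t i)\<^sup>2 / 2)))"
      by (intro prod.cong refl) (simp add: law char_std_normal_distribution)
    also have "\<dots> = of_real (exp (\<Sum>i\<in>I. - (t i)\<^sup>2 / 2))"
      using I by (simp only: exp_sum of_real_prod)
    also have "(\<Sum>i\<in>I. - (t i)\<^sup>2 / 2) = - (\<Sum>i\<in>I. (t i)\<^sup>2) / 2"
      by (simp only: sum_divide_distrib sum_negf[symmetric])
    finally show ?thesis unfolding ch ..
  qed
  show ?thesis
  proof (rule PiM_eqI[OF I])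
    show "sets (distr M (Pi\<^sub>M I (\<lambda>_. borel)) (\<lambda>x. \<lambda>i\<in>I. V i x)) = sets (Pi\<^sub>M I (\<lambda>_. std_normal_distribution))"
      by (auto intro!: sets_PiM_cong)
    fix A assume A: "\<And>i. i \<in> I \<Longrightarrow> A i \<in> sets std_normal_distribution"
    then have A': "\<And>i. i \<in> I \<Longrightarrow> A i \<in> sets borel" by simp
    have "emeasure (distr M (Pi\<^sub>M I (\<lambda>_. borel)) (\<lambda>x. \<lambda>i\<in>I. V i x)) (Pi\<^sub>E I A)
        = emeasure M ((\<lambda>x. \<lambda>i\<in>I. V i x) -` Pi\<^sub>E I A \<inter> space M)"
      using I A' by (intro emeasure_distr sets_PiM_I_finite) auto
    also have "(\<lambda>x. \<lambda>i\<in>I. V i x) -` Pi\<^sub>E I A \<inter> space M = {x\<in>space M. \<forall>i\<in>I. V i x \<in> A i}"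
      by auto
    also have "emeasure M \<dots> = ennreal (\<Prod>i\<in>I. measure (distr M borel (V i)) (A i))"
      using prob_prod_of_char_prod[OF I V ch' A'] by (simp add: emeasure_eq_measure)
    also have "\<dots> = (\<Prod>i\<in>I. emeasure std_normal_distribution (A i))"
    proof -
      interpret N: prob_space std_normal_distribution
        using real_dist_normal_dist by (simp add: real_distribution_def)
      show ?thesis by (simp add: law N.emeasure_eq_measure prod_ennreal cong: prod.cong)
    qed
    finally show "emeasure (distr M (Pi\<^sub>M I (\<lambda>_. borel)) (\<lambda>x. \<lambda>i\<in>I. V i x)) (Pi\<^sub>E I A)
        = (\<Prod>i\<in>I. emeasure std_normal_distribution (A i))" .
  qed
qed

section \<open>Translations of the standard Gaussian product measure\<close>

lemma std_normal_shift:
  "distr std_normal_distribution borel (\<lambda>y. y + c) = density std_normal_distribution (\<lambda>y. ennreal (exp (c * y - c\<^sup>2 / 2)))"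
proof (rule measure_eqI)
  fix A :: "real set" assume "A \<in> sets (distr std_normal_distribution borel (\<lambda>y. y + c))"
  then have A[measurable]: "A \<in> sets borel" by simp
  have "emeasure (distr std_normal_distribution borel (\<lambda>y. y + c)) A
      = (\<integral>\<^sup>+y. indicator A y \<partial>distr std_normal_distribution borel (\<lambda>y. y + c))"
    by simp
  also have "\<dots> = (\<integral>\<^sup>+y. indicator A (y + c) \<partial>std_normal_distribution)"
    by (rule nn_integral_distr) measurable
  also have "\<dots> = (\<integral>\<^sup>+y. ennreal (std_normal_density y) * indicator A (y + c) \<partial>lborel)"
    by (rule nn_integral_density) measurable
  also have "\<dots> = (\<integral>\<^sup>+y. ennreal (std_normal_density (y - c)) * indicator A y \<partial>lborel)"
    by (subst (2) nn_integral_real_affine[where c=1 and t=c]) (auto simp: add.commute)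
  also have "\<dots> = (\<integral>\<^sup>+y. ennreal (std_normal_density y) * (ennreal (exp (c * y - c\<^sup>2 / 2)) * indicator A y) \<partial>lborel)"
  proof (intro nn_integral_cong)
    fix y :: real
    \<comment> \<open>Completing the square:
      \<open>- (y - c)^2 / 2 = - y^2 / 2 + (c * y - c^2 / 2)\<close>.\<close>
    have "std_normal_density (y - c) = std_normal_density y * exp (c * y - c\<^sup>2 / 2)"
      unfolding std_normal_density_def mult.assoc exp_add[symmetric]
      by (simp add: power2_eq_square field_simps)
    then show "ennreal (std_normal_density (y - c)) * indicator A y
        = ennreal (std_normal_density y) * (ennreal (exp (c * y - c\<^sup>2 / 2)) * indicator A y)"
      by (simp add: ennreal_mult mult.assoc)
  qed
  also have "\<dots> = emeasure (density std_normal_distribution (\<lambda>y. ennreal (exp (c * y - c\<^sup>2 / 2)))) A"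
    by (subst emeasure_density, simp, simp, subst nn_integral_density) auto
  finally show "emeasure (distr std_normal_distribution borel (\<lambda>y. y + c)) A
      = emeasure (density std_normal_distribution (\<lambda>y. ennreal (exp (c * y - c\<^sup>2 / 2)))) A" .
qed simp

text \<open>Both sides are identified with the product \<open>Pi\<^sub>M I ?N\<close> of the shifted
  one-dimensional laws by comparing boxes, on which the exponential of the sum splits into
  factors.\<close>

lemma cameron_martin_finite:
  fixes c :: "'i \<Rightarrow> real"
  assumes I: "finite I"
  defines "\<gamma> \<equiv> Pi\<^sub>M I (\<lambda>_. std_normal_distribution)"
  shows "distr \<gamma> (Pi\<^sub>M I (\<lambda>_. borel)) (\<lambda>w. \<lambda>i\<in>I. w i + c i)
    = density \<gamma> (\<lambda>w. ennreal (exp (\<Sum>i\<in>I. c i * w i - (c i)\<^sup>2 / 2)))"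
proof -
  interpret N: prob_space std_normal_distribution
    using real_dist_normal_dist by (simp add: real_distribution_def)
  interpret S: product_sigma_finite "\<lambda>_::'i. std_normal_distribution"
    by (simp add: product_sigma_finite_def N.sigma_finite_measure_axioms)
  let ?N = "\<lambda>i. distr std_normal_distribution borel (\<lambda>y. y + c i)"
  have "prob_space (?N i)" for i by (rule N.prob_space_distr) simp
  then interpret S': product_sigma_finite ?N
    by (simp add: product_sigma_finite_def prob_space_imp_sigma_finite)
  have sets_\<gamma>: "sets \<gamma> = sets (Pi\<^sub>M I (\<lambda>_. borel))" unfolding \<gamma>_def by (auto intro!: sets_PiM_cong)
  have sets_N: "sets (Pi\<^sub>M I (\<lambda>_. borel)) = sets (Pi\<^sub>M I ?N)" by (auto intro!: sets_PiM_cong)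
  have space_\<gamma>: "space \<gamma> = Pi\<^sub>E I (\<lambda>_. UNIV)" unfolding \<gamma>_def by (simp add: space_PiM)
  have m[measurable]: "(\<lambda>w. \<lambda>i\<in>I. w i + c i) \<in> measurable \<gamma> (Pi\<^sub>M I (\<lambda>_. borel))"
    unfolding measurable_cong_sets[OF sets_\<gamma> refl] by measurable
  have "distr \<gamma> (Pi\<^sub>M I (\<lambda>_. borel)) (\<lambda>w. \<lambda>i\<in>I. w i + c i) = Pi\<^sub>M I ?N"
  proof (rule S'.PiM_eqI[OF I])
    fix A assume "\<And>i. i \<in> I \<Longrightarrow> A i \<in> sets (?N i)"
    then have A: "\<And>i. i \<in> I \<Longrightarrow> A i \<in> sets borel" by simp
    have "emeasure (distr \<gamma> (Pi\<^sub>M I (\<lambda>_. borel)) (\<lambda>w. \<lambda>i\<in>I. w i + c i)) (Pi\<^sub>E I A)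
        = emeasure \<gamma> ((\<lambda>w. \<lambda>i\<in>I. w i + c i) -` Pi\<^sub>E I A \<inter> space \<gamma>)"
      using I A by (intro emeasure_distr m sets_PiM_I_finite) auto
    also have "(\<lambda>w. \<lambda>i\<in>I. w i + c i) -` Pi\<^sub>E I A \<inter> space \<gamma> = Pi\<^sub>E I (\<lambda>i. (\<lambda>y. y + c i) -` A i)"
      unfolding space_\<gamma> by (auto simp: PiE_iff)
    also have "emeasure \<gamma> \<dots> = (\<Prod>i\<in>I. emeasure std_normal_distribution ((\<lambda>y. y + c i) -` A i))"
      unfolding \<gamma>_def
    proof (rule S.emeasure_PiM[OF I])
      fix i assume "i \<in> I"
      then show "(\<lambda>y. y + c i) -` A i \<in> sets std_normal_distribution"
        using measurable_sets[of "\<lambda>y. y + c i" borel borel "A i"] A by simp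
    qed
    also have "\<dots> = (\<Prod>i\<in>I. emeasure (?N i) (A i))"
      using A by (intro prod.cong refl) (simp add: emeasure_distr)
    finally show "emeasure (distr \<gamma> (Pi\<^sub>M I (\<lambda>_. borel)) (\<lambda>w. \<lambda>i\<in>I. w i + c i)) (Pi\<^sub>E I A)
        = (\<Prod>i\<in>I. emeasure (?N i) (A i))" .
  qed (simp add: sets_N)
  also have "\<dots> = density \<gamma> (\<lambda>w. ennreal (exp (\<Sum>i\<in>I. c i * w i - (c i)\<^sup>2 / 2)))"
  proof (rule S'.PiM_eqI[OF I, symmetric])
    show "sets (density \<gamma> (\<lambda>w. ennreal (exp (\<Sum>i\<in>I. c i * w i - (c i)\<^sup>2 / 2)))) = sets (Pi\<^sub>M I ?N)"
      using sets_\<gamma> sets_N by simp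
    fix A assume "\<And>i. i \<in> I \<Longrightarrow> A i \<in> sets (?N i)"
    then have A: "\<And>i. i \<in> I \<Longrightarrow> A i \<in> sets borel" by simp
    have d: "(\<lambda>w. ennreal (exp (\<Sum>i\<in>I. c i * w i - (c i)\<^sup>2 / 2))) \<in> borel_measurable \<gamma>"
      unfolding measurable_cong_sets[OF sets_\<gamma> refl] by measurable
    have "emeasure (density \<gamma> (\<lambda>w. ennreal (exp (\<Sum>i\<in>I. c i * w i - (c i)\<^sup>2 / 2)))) (Pi\<^sub>E I A)
        = (\<integral>\<^sup>+w. ennreal (exp (\<Sum>i\<in>I. c i * w i - (c i)\<^sup>2 / 2)) * indicator (Pi\<^sub>E I A) w \<partial>\<gamma>)"
      using I A by (intro emeasure_density[OF d]) (auto simp: sets_\<gamma> intro!: sets_PiM_I_finite)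
    also have "\<dots> = (\<integral>\<^sup>+w. (\<Prod>i\<in>I. ennreal (exp (c i * w i - (c i)\<^sup>2 / 2)) * indicator (A i) (w i)) \<partial>\<gamma>)"
    proof (intro nn_integral_cong)
      fix w assume "w \<in> space \<gamma>"
      then have "indicator (Pi\<^sub>E I A) w = (\<Prod>i\<in>I. indicator (A i) (w i) :: ennreal)"
        using I unfolding space_\<gamma> by (auto simp: indicator_def PiE_iff prod_zero_iff)
      then show "ennreal (exp (\<Sum>i\<in>I. c i * w i - (c i)\<^sup>2 / 2)) * indicator (Pi\<^sub>E I A) w
          = (\<Prod>i\<in>I. ennreal (exp (c i * w i - (c i)\<^sup>2 / 2)) * indicator (A i) (w i))"
        using I by (simp add: exp_sum prod_ennreal prod.distrib)
    qed
    also have "\<dots> = (\<Prod>i\<in>I. \<integral>\<^sup>+y. ennreal (exp (c i * y - (c i)\<^sup>2 / 2)) * indicator (A i) y \<partial>std_normal_distribution)"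
      unfolding \<gamma>_def using A by (intro S.product_nn_integral_prod[OF I]) auto
    also have "\<dots> = (\<Prod>i\<in>I. emeasure (?N i) (A i))"
      using A by (intro prod.cong refl) (auto simp: std_normal_shift emeasure_density)
    finally show "emeasure (density \<gamma> (\<lambda>w. ennreal (exp (\<Sum>i\<in>I. c i * w i - (c i)\<^sup>2 / 2)))) (Pi\<^sub>E I A)
        = (\<Prod>i\<in>I. emeasure (?N i) (A i))" .
  qed
  finally show ?thesis .
qed

text \<open>The event is split according to whether the density of the shifted measure, at the
  shifted point, exceeds \<open>exp L\<close>. Where it does not, the density is replaced by
  \<open>exp L\<close>; the rest is kept as an additive error.\<close>

lemma gaussian_shift_bound:
  fixes c :: "'i \<Rightarrow> real"
  assumes I: "finite I" and B: "B \<in> sets (Pi\<^sub>M I (\<lambda>_. borel))"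
  defines "\<gamma> \<equiv> Pi\<^sub>M I (\<lambda>_. std_normal_distribution)"
  shows "emeasure \<gamma> {w\<in>space \<gamma>. (\<lambda>i\<in>I. w i + c i) \<in> B}
    \<le> ennreal (exp L) * emeasure \<gamma> B + emeasure \<gamma> {w\<in>space \<gamma>. (\<Sum>i\<in>I. c i * w i + (c i)\<^sup>2 / 2) > L}"
proof -
  have sets_\<gamma>[measurable_cong]: "sets \<gamma> = sets (Pi\<^sub>M I (\<lambda>_. borel))" unfolding \<gamma>_def by (auto intro!: sets_PiM_cong)
  have space_\<gamma>: "space \<gamma> = space (Pi\<^sub>M I (\<lambda>_. borel))" by (rule sets_eq_imp_space_eq) (rule sets_\<gamma>)
  note B[measurable]
  let ?T = "\<lambda>w. \<lambda>i\<in>I. w i + c i"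
  let ?B = "{w\<in>space \<gamma>. w \<in> B \<and> (\<Sum>i\<in>I. c i * w i - (c i)\<^sup>2 / 2) \<le> L}"
  have B'[measurable]: "?B \<in> sets (Pi\<^sub>M I (\<lambda>_. borel))" unfolding space_\<gamma> by measurable
  have "?T w \<in> ?B" if w: "w \<in> space \<gamma>" "?T w \<in> B" "\<not> (\<Sum>i\<in>I. c i * w i + (c i)\<^sup>2 / 2) > L" for w
  proof -
    \<comment> \<open>Evaluating the log-density at the shifted point adds \<open>(c i)^2\<close> to
      each term, which turns \<open>- (c i)^2 / 2\<close> into \<open>+ (c i)^2 / 2\<close>.\<close>
    have "(\<Sum>i\<in>I. c i * ?T w i - (c i)\<^sup>2 / 2) = (\<Sum>i\<in>I. c i * w i + (c i)\<^sup>2 / 2)"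
      by (intro sum.cong refl) (simp add: power2_eq_square field_simps)
    then show ?thesis using w sets.sets_into_space[OF B] space_\<gamma> by auto
  qed
  then have "{w\<in>space \<gamma>. ?T w \<in> B} \<subseteq> (?T -` ?B \<inter> space \<gamma>) \<union> {w\<in>space \<gamma>. (\<Sum>i\<in>I. c i * w i + (c i)\<^sup>2 / 2) > L}"
    by blast
  then have "emeasure \<gamma> {w\<in>space \<gamma>. ?T w \<in> B}
      \<le> emeasure \<gamma> ((?T -` ?B \<inter> space \<gamma>) \<union> {w\<in>space \<gamma>. (\<Sum>i\<in>I. c i * w i + (c i)\<^sup>2 / 2) > L})"
    by (rule emeasure_mono) measurable
  also have "\<dots> \<le> emeasure \<gamma> (?T -` ?B \<inter> space \<gamma>) + emeasure \<gamma> {w\<in>space \<gamma>. (\<Sum>i\<in>I. c i * w i + (c i)\<^sup>2 / 2) > L}"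
    by (rule emeasure_subadditive) measurable
  finally have split: "emeasure \<gamma> {w\<in>space \<gamma>. ?T w \<in> B} \<le> emeasure \<gamma> (?T -` ?B \<inter> space \<gamma>)
      + emeasure \<gamma> {w\<in>space \<gamma>. (\<Sum>i\<in>I. c i * w i + (c i)\<^sup>2 / 2) > L}" .
  have "emeasure \<gamma> (?T -` ?B \<inter> space \<gamma>) = emeasure (distr \<gamma> (Pi\<^sub>M I (\<lambda>_. borel)) ?T) ?B"
    by (rule emeasure_distr[symmetric]) measurable
  also have "\<dots> = (\<integral>\<^sup>+w. ennreal (exp (\<Sum>i\<in>I. c i * w i - (c i)\<^sup>2 / 2)) * indicator ?B w \<partial>\<gamma>)"
    unfolding cameron_martin_finite[OF I, folded \<gamma>_def] by (rule emeasure_density) measurable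
  also have "\<dots> \<le> (\<integral>\<^sup>+w. ennreal (exp L) * indicator B w \<partial>\<gamma>)"
    by (intro nn_integral_mono) (auto simp: indicator_def intro!: ennreal_leI)
  also have "\<dots> = ennreal (exp L) * emeasure \<gamma> B"
    by (rule nn_integral_cmult_indicator) (simp add: sets_\<gamma> B)
  finally show ?thesis using split by (meson add_right_mono order_trans)
qed

section \<open>Random shifts and the tail of the log-likelihood ratio\<close>

lemma (in prob_space) emeasure_indep_pair:
  assumes ind: "indep_var S \<xi> T \<zeta>" and Z: "Z \<in> sets (S \<Otimes>\<^sub>M T)"
  shows "emeasure M {x\<in>space M. (\<xi> x, \<zeta> x) \<in> Z} = (\<integral>\<^sup>+x. emeasure (distr M T \<zeta>) (Pair x -` Z) \<partial>distr M S \<xi>)"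
proof -
  have [measurable]: "\<xi> \<in> measurable M S" "\<zeta> \<in> measurable M T"
    using ind by (auto dest: indep_var_rv1 indep_var_rv2)
  interpret Q: prob_space "distr M T \<zeta>" by (rule prob_space_distr) measurable
  have "{x\<in>space M. (\<xi> x, \<zeta> x) \<in> Z} = (\<lambda>x. (\<xi> x, \<zeta> x)) -` Z \<inter> space M" by auto
  then have "emeasure M {x\<in>space M. (\<xi> x, \<zeta> x) \<in> Z} = emeasure (distr M (S \<Otimes>\<^sub>M T) (\<lambda>x. (\<xi> x, \<zeta> x))) Z"
    using Z by (simp add: emeasure_distr)
  also have "distr M (S \<Otimes>\<^sub>M T) (\<lambda>x. (\<xi> x, \<zeta> x)) = distr M S \<xi> \<Otimes>\<^sub>M distr M T \<zeta>"
    using ind by (simp add: indep_var_distribution_eq)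
  also have "emeasure \<dots> Z = (\<integral>\<^sup>+x. emeasure (distr M T \<zeta>) (Pair x -` Z) \<partial>distr M S \<xi>)"
    by (rule Q.emeasure_pair_measure_alt) (use Z in \<open>simp add: sets_pair_measure_cong[of "distr M S \<xi>" S "distr M T \<zeta>" T]\<close>)
  finally show ?thesis .
qed

text \<open>Independence turns conditioning on \<open>\<xi>\<close> into integration of sections
  over its law. In the section at \<open>x\<close>, \<open>\<zeta>\<close> keeps its standard
  Gaussian law, and passing from \<open>\<beta>1\<close> to \<open>\<beta>2\<close> is translation
  by the deterministic vector \<open>(\<beta>2 - \<beta>1) * x i\<close>.\<close>

lemma (in prob_space) random_gaussian_shift_bound:
  fixes \<xi> \<zeta> :: "'a \<Rightarrow> 'i \<Rightarrow> real"
  assumes I: "finite I"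
    and ind: "indep_var (Pi\<^sub>M I (\<lambda>_. borel)) \<xi> (Pi\<^sub>M I (\<lambda>_. borel)) \<zeta>"
    and law: "distr M (Pi\<^sub>M I (\<lambda>_. borel)) \<zeta> = Pi\<^sub>M I (\<lambda>_. std_normal_distribution)"
    and Q: "Q \<in> sets (Pi\<^sub>M I (\<lambda>_. borel) \<Otimes>\<^sub>M Pi\<^sub>M I (\<lambda>_. borel))"
  shows "emeasure M {x\<in>space M. (\<xi> x, \<lambda>i\<in>I. \<beta>2 * \<xi> x i + \<zeta> x i) \<in> Q}
    \<le> ennreal (exp L) * emeasure M {x\<in>space M. (\<xi> x, \<lambda>i\<in>I. \<beta>1 * \<xi> x i + \<zeta> x i) \<in> Q}
      + emeasure M {x\<in>space M. (\<Sum>i\<in>I. (\<beta>2 - \<beta>1) * \<xi> x i * \<zeta> x i + ((\<beta>2 - \<beta>1) * \<xi> x i)\<^sup>2 / 2) > L}"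
proof -
  let ?P = "Pi\<^sub>M I (\<lambda>_. borel :: real measure)"
  let ?\<gamma> = "Pi\<^sub>M I (\<lambda>_. std_normal_distribution)"
  let ?\<nu> = "distr M ?P \<xi>"
  note Q[measurable]
  define Z where "Z \<beta> = {p \<in> space (?P \<Otimes>\<^sub>M ?P). (fst p, \<lambda>i\<in>I. \<beta> * fst p i + snd p i) \<in> Q}" for \<beta>
  define E where "E = {p \<in> space (?P \<Otimes>\<^sub>M ?P). (\<Sum>i\<in>I. (\<beta>2 - \<beta>1) * fst p i * snd p i + ((\<beta>2 - \<beta>1) * fst p i)\<^sup>2 / 2) > L}"
  have Z[measurable]: "Z \<beta> \<in> sets (?P \<Otimes>\<^sub>M ?P)" for \<beta> unfolding Z_def by measurable
  have E[measurable]: "E \<in> sets (?P \<Otimes>\<^sub>M ?P)" unfolding E_def by measurable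
  have \<xi>: "\<xi> \<in> measurable M ?P" and \<zeta>: "\<zeta> \<in> measurable M ?P"
    using ind by (auto dest: indep_var_rv1 indep_var_rv2)
  have in_space: "(\<xi> x, \<zeta> x) \<in> space (?P \<Otimes>\<^sub>M ?P)" if "x \<in> space M" for x
    using measurable_space[OF \<xi> that] measurable_space[OF \<zeta> that] by (simp add: space_pair_measure)
  have sets_\<gamma>: "sets ?\<gamma> = sets ?P" by (auto intro!: sets_PiM_cong)
  have space_\<gamma>: "space ?\<gamma> = space ?P" by (rule sets_eq_imp_space_eq) (rule sets_\<gamma>)
  note pair = emeasure_indep_pair[OF ind, unfolded law]
  have ZM: "{x\<in>space M. (\<xi> x, \<lambda>i\<in>I. \<beta> * \<xi> x i + \<zeta> x i) \<in> Q} = {x\<in>space M. (\<xi> x, \<zeta> x) \<in> Z \<beta>}" for \<beta>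
    using in_space by (auto simp: Z_def)
  have EM: "{x\<in>space M. (\<Sum>i\<in>I. (\<beta>2 - \<beta>1) * \<xi> x i * \<zeta> x i + ((\<beta>2 - \<beta>1) * \<xi> x i)\<^sup>2 / 2) > L} = {x\<in>space M. (\<xi> x, \<zeta> x) \<in> E}"
    using in_space by (auto simp: E_def)
  have pt: "emeasure ?\<gamma> (Pair x -` Z \<beta>2) \<le> ennreal (exp L) * emeasure ?\<gamma> (Pair x -` Z \<beta>1) + emeasure ?\<gamma> (Pair x -` E)"
    if x: "x \<in> space ?P" for x
  proof -
    let ?c = "\<lambda>i. (\<beta>2 - \<beta>1) * x i"
    have B: "Pair x -` Z \<beta>1 \<in> sets ?P" by (rule sets_Pair1) (rule Z)
    have "Pair x -` Z \<beta>2 = {w\<in>space ?\<gamma>. (\<lambda>i\<in>I. w i + ?c i) \<in> Pair x -` Z \<beta>1}"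
    proof -
      have "(\<lambda>i\<in>I. \<beta>1 * x i + (\<lambda>i\<in>I. w i + ?c i) i) = (\<lambda>i\<in>I. \<beta>2 * x i + w i)" for w
        by (auto simp: restrict_def algebra_simps)
      moreover have "(\<lambda>i\<in>I. w i + ?c i) \<in> space ?P" for w
        by (simp add: space_PiM)
      ultimately show ?thesis using x by (auto simp: Z_def space_pair_measure space_\<gamma>)
    qed
    moreover have "Pair x -` E = {w\<in>space ?\<gamma>. (\<Sum>i\<in>I. ?c i * w i + (?c i)\<^sup>2 / 2) > L}"
      using x by (auto simp: E_def space_pair_measure space_\<gamma>)
    ultimately show ?thesis using gaussian_shift_bound[OF I B, of ?c L] by simp
  qed
  have meas: "(\<lambda>x. emeasure ?\<gamma> (Pair x -` S)) \<in> borel_measurable ?P" if S: "S \<in> sets (?P \<Otimes>\<^sub>M ?P)" for S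
  proof -
    interpret G: prob_space ?\<gamma> unfolding law[symmetric] by (rule prob_space_distr) (rule \<zeta>)
    show ?thesis
      by (rule G.measurable_emeasure_Pair) (use S in \<open>simp add: sets_pair_measure_cong[OF refl sets_\<gamma>]\<close>)
  qed
  have [measurable]: "(\<lambda>x. emeasure ?\<gamma> (Pair x -` Z \<beta>)) \<in> borel_measurable ?\<nu>"
    "(\<lambda>x. emeasure ?\<gamma> (Pair x -` E)) \<in> borel_measurable ?\<nu>" for \<beta>
    using meas Z E by simp_all
  have "(\<integral>\<^sup>+x. emeasure ?\<gamma> (Pair x -` Z \<beta>2) \<partial>?\<nu>)
      \<le> (\<integral>\<^sup>+x. (ennreal (exp L) * emeasure ?\<gamma> (Pair x -` Z \<beta>1) + emeasure ?\<gamma> (Pair x -` E)) \<partial>?\<nu>)"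
    by (intro nn_integral_mono pt) simp
  also have "\<dots> = ennreal (exp L) * (\<integral>\<^sup>+x. emeasure ?\<gamma> (Pair x -` Z \<beta>1) \<partial>?\<nu>)
      + (\<integral>\<^sup>+x. emeasure ?\<gamma> (Pair x -` E) \<partial>?\<nu>)"
    by (subst nn_integral_add) (auto simp: nn_integral_cmult)
  finally show ?thesis unfolding ZM EM pair[OF Z] pair[OF E] .
qed

text \<open>The coordinates of \<open>\<xi>\<close> may be correlated: orthonormality of
  \<open>\<zeta>\<close> and independence alone remove the cross terms, so the second moment of
  \<open>\<Sum>i\<in>I. \<xi> x i * \<zeta> x i\<close> is the sum of the second moments of the
  \<open>\<xi> x i\<close>. Markov's inequality then needs nothing beyond
  \<open>\<tau>\<close>.\<close>

lemma (in prob_space) log_likelihood_tail: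
  fixes \<xi> \<zeta> :: "'a \<Rightarrow> 'i \<Rightarrow> real"
  assumes I: "finite I" and L: "L > 0"
    and ind: "indep_var (Pi\<^sub>M I (\<lambda>_. borel)) \<xi> (Pi\<^sub>M I (\<lambda>_. borel)) \<zeta>"
    and \<xi>_int: "\<And>i j. i \<in> I \<Longrightarrow> j \<in> I \<Longrightarrow> integrable M (\<lambda>x. \<xi> x i * \<xi> x j)"
    and \<zeta>_int: "\<And>i j. i \<in> I \<Longrightarrow> j \<in> I \<Longrightarrow> integrable M (\<lambda>x. \<zeta> x i * \<zeta> x j)"
    and \<zeta>_cov: "\<And>i j. i \<in> I \<Longrightarrow> j \<in> I \<Longrightarrow> (LINT x|M. \<zeta> x i * \<zeta> x j) = (if i = j then 1 else 0)"
    and \<tau>: "(\<Sum>i\<in>I. (LINT x|M. (\<xi> x i)\<^sup>2)) \<le> \<tau>"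
  shows "emeasure M {x\<in>space M. (\<Sum>i\<in>I. \<delta> * \<xi> x i * \<zeta> x i + (\<delta> * \<xi> x i)\<^sup>2 / 2) > L}
    \<le> ennreal ((\<bar>\<delta>\<bar> * (1 + \<tau>) / 2 + \<delta>\<^sup>2 * \<tau> / 2) / L)"
proof -
  have \<xi>m[measurable]: "\<xi> \<in> measurable M (Pi\<^sub>M I (\<lambda>_. borel))" and \<zeta>m[measurable]: "\<zeta> \<in> measurable M (Pi\<^sub>M I (\<lambda>_. borel))"
    using ind by (auto dest: indep_var_rv1 indep_var_rv2)
  have [measurable]: "(\<lambda>x. \<xi> x i) \<in> borel_measurable M" "(\<lambda>x. \<zeta> x i) \<in> borel_measurable M" if "i \<in> I" for i
    using measurable_compose[OF \<xi>m measurable_component_singleton[OF that]]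
      measurable_compose[OF \<zeta>m measurable_component_singleton[OF that]] by simp_all
  have indij: "indep_var borel (\<lambda>x. \<xi> x i * \<xi> x j) borel (\<lambda>x. \<zeta> x i * \<zeta> x j)" if "i \<in> I" "j \<in> I" for i j
  proof -
    have m: "(\<lambda>w. w i * w j :: real) \<in> borel_measurable (Pi\<^sub>M I (\<lambda>_. borel))"
      using that by measurable
    show ?thesis using indep_var_compose[OF ind m m] by (simp add: o_def)
  qed
  have e4: "integrable M (\<lambda>x. (\<xi> x i * \<xi> x j) * (\<zeta> x i * \<zeta> x j))"
    "(LINT x|M. (\<xi> x i * \<xi> x j) * (\<zeta> x i * \<zeta> x j)) = (LINT x|M. \<xi> x i * \<xi> x j) * (if i = j then 1 else 0)"
    if "i \<in> I" "j \<in> I" for i j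
    using indep_var_integrable[OF indij[OF that] \<xi>_int[OF that] \<zeta>_int[OF that]]
      indep_var_lebesgue_integral[OF indij[OF that] \<xi>_int[OF that] \<zeta>_int[OF that]] \<zeta>_cov[OF that] by simp_all
  have sq: "(\<Sum>i\<in>I. \<xi> x i * \<zeta> x i)\<^sup>2 = (\<Sum>i\<in>I. \<Sum>j\<in>I. (\<xi> x i * \<xi> x j) * (\<zeta> x i * \<zeta> x j))" for x
    unfolding power2_eq_square sum_product by (intro sum.cong refl) simp
  have sq_int: "integrable M (\<lambda>x. (\<Sum>i\<in>I. \<xi> x i * \<zeta> x i)\<^sup>2)"
    unfolding sq by (intro Bochner_Integration.integrable_sum e4)
  have "(LINT x|M. (\<Sum>i\<in>I. \<xi> x i * \<zeta> x i)\<^sup>2) = (\<Sum>i\<in>I. \<Sum>j\<in>I. (LINT x|M. \<xi> x i * \<xi> x j) * (if i = j then 1 else 0))"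
    unfolding sq using e4 by (simp add: Bochner_Integration.integral_sum Bochner_Integration.integrable_sum cong: sum.cong)
  also have "\<dots> = (\<Sum>i\<in>I. (LINT x|M. (\<xi> x i)\<^sup>2))"
    using I by (simp add: power2_eq_square if_distrib[where f="\<lambda>c. _ * c"] cong: if_cong)
  finally have sq_eq: "(LINT x|M. (\<Sum>i\<in>I. \<xi> x i * \<zeta> x i)\<^sup>2) \<le> \<tau>" using \<tau> by simp
  have \<xi>sq_int: "integrable M (\<lambda>x. \<Sum>i\<in>I. (\<xi> x i)\<^sup>2)"
    using \<xi>_int by (intro Bochner_Integration.integrable_sum) (simp add: power2_eq_square)
  have \<xi>sq_eq: "(LINT x|M. (\<Sum>i\<in>I. (\<xi> x i)\<^sup>2)) \<le> \<tau>"
    using \<xi>_int \<tau> by (subst Bochner_Integration.integral_sum) (auto simp: power2_eq_square)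
  \<comment> \<open>A nonnegative majorant of the log-likelihood ratio, obtained from
    \<open>\<bar>u\<bar> \<le> (1 + u^2) / 2\<close>; its mean is at most the numerator of the
    claimed bound.\<close>
  define H where "H x = \<bar>\<delta>\<bar> * (1 + (\<Sum>i\<in>I. \<xi> x i * \<zeta> x i)\<^sup>2) / 2 + \<delta>\<^sup>2 / 2 * (\<Sum>i\<in>I. (\<xi> x i)\<^sup>2)" for x
  have H_int: "integrable M H" unfolding H_def using sq_int \<xi>sq_int by simp
  have "(LINT x|M. H x) = \<bar>\<delta>\<bar> * (1 + (LINT x|M. (\<Sum>i\<in>I. \<xi> x i * \<zeta> x i)\<^sup>2)) / 2 + \<delta>\<^sup>2 / 2 * (LINT x|M. (\<Sum>i\<in>I. (\<xi> x i)\<^sup>2))"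
    unfolding H_def using sq_int \<xi>sq_int by (simp add: prob_space)
  also have "\<dots> \<le> \<bar>\<delta>\<bar> * (1 + \<tau>) / 2 + \<delta>\<^sup>2 / 2 * \<tau>"
    using sq_eq \<xi>sq_eq by (intro add_mono divide_right_mono mult_left_mono) auto
  finally have EH: "(LINT x|M. H x) \<le> \<bar>\<delta>\<bar> * (1 + \<tau>) / 2 + \<delta>\<^sup>2 * \<tau> / 2" by simp
  have H0: "H x \<ge> 0" for x unfolding H_def by (simp add: sum_nonneg)
  have S_le: "(\<Sum>i\<in>I. \<delta> * \<xi> x i * \<zeta> x i + (\<delta> * \<xi> x i)\<^sup>2 / 2) \<le> H x" for x
  proof -
    let ?u = "\<Sum>i\<in>I. \<xi> x i * \<zeta> x i"
    have "(\<Sum>i\<in>I. \<delta> * \<xi> x i * \<zeta> x i + (\<delta> * \<xi> x i)\<^sup>2 / 2) = \<delta> * ?u + \<delta>\<^sup>2 / 2 * (\<Sum>i\<in>I. (\<xi> x i)\<^sup>2)"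
      by (simp add: sum.distrib sum_distrib_left power_mult_distrib mult.assoc)
    moreover have "\<delta> * ?u \<le> \<bar>\<delta>\<bar> * ((1 + ?u\<^sup>2) / 2)"
    proof -
      have "\<bar>?u\<bar> \<le> (1 + ?u\<^sup>2) / 2"
        using zero_le_power2[of "\<bar>?u\<bar> - 1"] by (simp add: power2_diff)
      then have "\<bar>\<delta>\<bar> * \<bar>?u\<bar> \<le> \<bar>\<delta>\<bar> * ((1 + ?u\<^sup>2) / 2)" by (rule mult_left_mono) simp
      then show ?thesis using abs_ge_self[of "\<delta> * ?u"] by (simp add: abs_mult)
    qed
    ultimately show ?thesis unfolding H_def by simp
  qed
  have "emeasure M {x\<in>space M. (\<Sum>i\<in>I. \<delta> * \<xi> x i * \<zeta> x i + (\<delta> * \<xi> x i)\<^sup>2 / 2) > L}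
      \<le> emeasure M {x\<in>space M. L \<le> H x}"
    using S_le H_int by (intro emeasure_mono) (auto intro: less_imp_le less_le_trans)
  also have "\<dots> \<le> ennreal ((LINT x|M. H x) / L)"
    using integral_Markov_inequality[OF H_int, of L] H0 L by simp
  also have "\<dots> \<le> ennreal ((\<bar>\<delta>\<bar> * (1 + \<tau>) / 2 + \<delta>\<^sup>2 * \<tau> / 2) / L)"
    using EH L by (intro ennreal_leI divide_right_mono) auto
  finally show ?thesis .
qed

section \<open>Extension from a generating algebra to the generated \<sigma>-algebra\<close>

text \<open>The sets that can be approximated by members of the algebra, for both measures at once, form a
  \<open>\<sigma>\<close>-algebra.\<close>

lemma bound_extends_from_generating_algebra:
  assumes P: "finite_measure P" and Q: "finite_measure Q" and sets: "sets P = sets Q"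
    and alg: "algebra (space P) \<A>" and gen: "sets P = sigma_sets (space P) \<A>"
    and bound: "\<And>A. A \<in> \<A> \<Longrightarrow> emeasure Q A \<le> K * emeasure P A + e" and K: "K < \<infinity>"
    and A: "A \<in> sets P"
  shows "emeasure Q A \<le> K * emeasure P A + e"
proof -
  interpret P: finite_measure P by (rule P)
  interpret Q: finite_measure Q by (rule Q)
  interpret \<A>: algebra "space P" \<A> by (rule alg)
  have [measurable_cong]: "sets Q = sets P" using sets by simp
  have \<A>_sets: "B \<in> sets P" if "B \<in> \<A>" for B unfolding gen using that by (rule sigma_sets.Basic)
  \<comment> \<open>Measuring symmetric differences by the sum of both measures yields one
    approximating set that is good for \<open>P\<close> and \<open>Q\<close> simultaneously.\<close>
  define m where "m X = measure P X + measure Q X" for X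
  have m_mono: "m X \<le> m Y" if "X \<subseteq> Y" "Y \<in> sets P" for X Y
  proof -
    have "Y \<in> sets Q" using that(2) unfolding sets .
    then show ?thesis
      unfolding m_def by (intro add_mono P.finite_measure_mono Q.finite_measure_mono that)
  qed
  have "\<exists>B\<in>\<A>. m ((A - B) \<union> (B - A)) < \<eta>" if \<eta>: "\<eta> > 0" for \<eta>
    using A[unfolded gen] \<eta>
  proof (induction A arbitrary: \<eta>)
    case (Basic a)
    then show ?case by (intro bexI[of _ a]) (auto simp: m_def)
  next
    case Empty
    then show ?case by (intro bexI[of _ "{}"]) (auto simp: m_def)
  next
    case (Compl a)
    then obtain B where B: "B \<in> \<A>" "m ((a - B) \<union> (B - a)) < \<eta>" by blast
    have "a \<in> sets P" unfolding gen by (rule Compl.hyps)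
    then have "a \<subseteq> space P" "B \<subseteq> space P"
      using \<A>_sets[OF B(1)] by (auto dest: sets.sets_into_space)
    then have "(space P - a - (space P - B)) \<union> (space P - B - (space P - a)) = (a - B) \<union> (B - a)" by auto
    then show ?case using B by (intro bexI[of _ "space P - B"]) auto
  next
    case (Union a)
    have a[measurable]: "a i \<in> sets P" for i unfolding gen by (rule Union.hyps)
    \<comment> \<open>An algebra admits only finite unions, so the tail of the union is cut off
      first, using half of the allowed error.\<close>
    let ?R = "\<lambda>n. (\<Union>i. a i) - (\<Union>i<n. a i)"
    have dec: "decseq ?R" by (auto simp: decseq_def intro: less_le_trans)
    have R: "range ?R \<subseteq> sets P" by auto
    have "(\<Inter>n. ?R n) = {}" by auto
    then have "(\<lambda>n. m (?R n)) \<longlonglongrightarrow> 0 + 0"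
      using P.finite_Lim_measure_decseq[OF R dec] Q.finite_Lim_measure_decseq[OF R[unfolded sets] dec]
      unfolding m_def by (intro tendsto_add) (simp_all only: measure_empty)
    then have "\<forall>\<^sub>F n in sequentially. m (?R n) < \<eta> / 2"
      using Union.prems by (intro order_tendstoD) auto
    then obtain n where n: "m (?R n) < \<eta> / 2" by (auto simp: eventually_sequentially)
    \<comment> \<open>The other half is shared among \<open>n\<close> sets; dividing by
      \<open>n + 1\<close> keeps the share positive for \<open>n = 0\<close>.\<close>
    have "\<exists>B. B \<in> \<A> \<and> m ((a i - B) \<union> (B - a i)) < \<eta> / (2 * (real n + 1))" for i
      using Union.IH[of "\<eta> / (2 * (real n + 1))" i] Union.prems by auto
    then obtain B where B: "\<And>i. B i \<in> \<A>" "\<And>i. m ((a i - B i) \<union> (B i - a i)) < \<eta> / (2 * (real n + 1))"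
      by metis
    have Bm[measurable]: "B i \<in> sets P" for i using B(1) \<A>_sets by blast
    let ?D = "\<lambda>i. (a i - B i) \<union> (B i - a i)" and ?U = "\<Union>i<n. B i"
    have U: "?U \<in> \<A>" using B(1) by (intro \<A>.finite_UN) auto
    have "m (((\<Union>i. a i) - ?U) \<union> (?U - (\<Union>i. a i))) \<le> m (?R n \<union> (\<Union>i<n. ?D i))"
      by (intro m_mono) auto
    also have "\<dots> \<le> m (?R n) + m (\<Union>i<n. ?D i)"
    proof -
      have "measure P (?R n \<union> (\<Union>i<n. ?D i)) \<le> measure P (?R n) + measure P (\<Union>i<n. ?D i)"
        by (rule measure_Un_le) measurable
      moreover have "measure Q (?R n \<union> (\<Union>i<n. ?D i)) \<le> measure Q (?R n) + measure Q (\<Union>i<n. ?D i)"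
        by (rule measure_Un_le) measurable
      ultimately show ?thesis by (simp add: m_def)
    qed
    also have "m (\<Union>i<n. ?D i) \<le> (\<Sum>i<n. m (?D i))"
      unfolding m_def sum.distrib
      by (intro add_mono measure_UNION_le) auto
    also have "\<dots> \<le> (\<Sum>i<n. \<eta> / (2 * (real n + 1)))"
      by (intro sum_mono less_imp_le B)
    also have "\<dots> \<le> \<eta> / 2" using Union.prems by (simp add: field_simps)
    finally have "m (((\<Union>i. a i) - ?U) \<union> (?U - (\<Union>i. a i))) < \<eta>" using n by simp
    then show ?case using U by (intro bexI[of _ ?U]) auto
  qed
  note approx = this
  obtain k where k: "k \<ge> 0" "K = ennreal k" using K by (cases K) auto
  show ?thesis
  proof (rule ennreal_le_epsilon)
    fix \<epsilon> :: real assume \<epsilon>: "\<epsilon> > 0"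
    \<comment> \<open>Exchanging \<open>A\<close> for \<open>B\<close> costs one approximation error
      under \<open>Q\<close> and \<open>k\<close> times that error under \<open>P\<close>, hence the
      divisor \<open>k + 1\<close>.\<close>
    then obtain B where B: "B \<in> \<A>" "m ((A - B) \<union> (B - A)) < \<epsilon> / (k + 1)"
      using approx[of "\<epsilon> / (k + 1)"] k by auto
    let ?D = "(A - B) \<union> (B - A)" and ?h = "\<epsilon> / (k + 1)"
    note A[measurable]
    have [measurable]: "B \<in> sets P" using B(1) \<A>_sets by blast
    have "measure P ?D \<le> ?h" "measure Q ?D \<le> ?h"
      using B(2) measure_nonneg[of P ?D] measure_nonneg[of Q ?D] unfolding m_def by linarith+
    then have D: "emeasure P ?D \<le> ennreal ?h" "emeasure Q ?D \<le> ennreal ?h"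
      by (auto simp: P.emeasure_eq_measure Q.emeasure_eq_measure intro!: ennreal_leI)
    have "emeasure Q A \<le> emeasure Q (B \<union> ?D)" by (intro emeasure_mono) auto
    also have "\<dots> \<le> emeasure Q B + emeasure Q ?D" by (rule emeasure_subadditive) measurable
    also have "\<dots> \<le> (K * emeasure P B + e) + ennreal ?h" by (intro add_mono bound B D)
    finally have 1: "emeasure Q A \<le> (K * emeasure P B + e) + ennreal ?h" .
    have "emeasure P B \<le> emeasure P (A \<union> ?D)" by (intro emeasure_mono) auto
    also have "\<dots> \<le> emeasure P A + emeasure P ?D" by (rule emeasure_subadditive) measurable
    also have "\<dots> \<le> emeasure P A + ennreal ?h" by (intro add_mono D order_refl)
    finally have "K * emeasure P B \<le> K * (emeasure P A + ennreal ?h)" by (rule mult_left_mono) simp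
    then have "emeasure Q A \<le> K * (emeasure P A + ennreal ?h) + e + ennreal ?h"
      using 1 by (meson add_right_mono order_trans)
    also have "\<dots> = (K * emeasure P A + e) + (ennreal k * ennreal ?h + ennreal ?h)"
      by (simp add: k distrib_left ac_simps)
    also have "ennreal k * ennreal ?h + ennreal ?h = ennreal (k * ?h + ?h)"
      using k \<epsilon> by (subst ennreal_plus) (auto simp: ennreal_mult simp del: times_divide_eq_right)
    also have "k * ?h + ?h = (k + 1) * ?h" by (simp only: distrib_right mult_1)
    also have "\<dots> = \<epsilon>" using k by simp
    finally show "emeasure Q A \<le> K * emeasure P A + e + ennreal \<epsilon>" .
  qed
qed

section \<open>Finitely many observation points\<close>

text \<open>The form may be degenerate, so the vectors \<open>v s\<close> need not be independent: a
  residual of length 0 is dropped rather than normalised. Each vector is therefore represented only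
  up to a null vector, and the number \<open>m\<close> of directions is part of the result.\<close>

lemma gram_schmidt_semidefinite:
  fixes B :: "('s \<Rightarrow> real) \<Rightarrow> ('s \<Rightarrow> real) \<Rightarrow> real" and v :: "'s \<Rightarrow> 's \<Rightarrow> real"
  assumes T: "finite T"
    and lin: "\<And>p q r c. B (\<lambda>t. p t + c * q t) r = B p r + c * B q r"
    and sym: "\<And>p q. B p q = B q p" and nonneg: "\<And>p. B p p \<ge> 0"
  obtains m :: nat and a :: "nat \<Rightarrow> 's \<Rightarrow> real" and e :: "'s \<Rightarrow> nat \<Rightarrow> real"
  where "\<And>k l. k < m \<Longrightarrow> l < m \<Longrightarrow> B (a k) (a l) = (if k = l then 1 else 0)"
    "\<And>s. s \<in> T \<Longrightarrow> B (\<lambda>t. v s t - (\<Sum>k<m. e s k * a k t)) (\<lambda>t. v s t - (\<Sum>k<m. e s k * a k t)) = 0"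
proof -
  have lin_sum: "B (\<lambda>t. p t - (\<Sum>k<n. c k * a k t)) q = B p q - (\<Sum>k<n. c k * B (a k) q)"
    for p c and a :: "nat \<Rightarrow> 's \<Rightarrow> real" and q and n :: nat
  proof (induction n)
    case (Suc n)
    have "(\<lambda>t. p t - (\<Sum>k<Suc n. c k * a k t)) = (\<lambda>t. (p t - (\<Sum>k<n. c k * a k t)) + (- c n) * a n t)"
      by auto
    then have "B (\<lambda>t. p t - (\<Sum>k<Suc n. c k * a k t)) q = B (\<lambda>t. (p t - (\<Sum>k<n. c k * a k t)) + (- c n) * a n t) q"
      by (rule arg_cong)
    also have "\<dots> = B (\<lambda>t. p t - (\<Sum>k<n. c k * a k t)) q + (- c n) * B (a n) q"
      by (rule lin)
    finally show ?case unfolding Suc.IH by simp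
  qed simp
  have zero: "B (\<lambda>t. 0) q = 0" for q
    using lin[of "\<lambda>t. 0" "-1" "\<lambda>t. 0" q] by simp
  have scale: "B (\<lambda>t. c * p t) q = c * B p q" for c p q
    using lin[of "\<lambda>t. 0" c p q] zero by simp
  have "\<exists>(m::nat) a e. (\<forall>k<m. \<forall>l<m. B (a k) (a l) = (if k = l then 1 else 0)) \<and>
      (\<forall>s\<in>T. B (\<lambda>t. v s t - (\<Sum>k<m. e s k * a k t)) (\<lambda>t. v s t - (\<Sum>k<m. e s k * a k t)) = 0)"
    using T
  proof (induction T)
    case empty
    show ?case by (rule exI[of _ 0]) simp
  next
    case (insert s T)
    from insert.IH obtain m :: nat and a e where IH: "(\<forall>k<m. \<forall>l<m. B (a k) (a l) = (if k = l then 1 else 0)) \<and>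
        (\<forall>s\<in>T. B (\<lambda>t. v s t - (\<Sum>k<m. e s k * a k t)) (\<lambda>t. v s t - (\<Sum>k<m. e s k * a k t)) = 0)"
      by (elim exE)
    from IH have orth: "B (a k) (a l) = (if k = l then 1 else 0)" if "k < m" "l < m" for k l using that by blast
    from IH have res: "B (\<lambda>t. v s t - (\<Sum>k<m. e s k * a k t)) (\<lambda>t. v s t - (\<Sum>k<m. e s k * a k t)) = 0"
      if "s \<in> T" for s using that by blast
    define r where "r = (\<lambda>t. v s t - (\<Sum>k<m. B (v s) (a k) * a k t))"
    have r_orth: "B r (a l) = 0" if "l < m" for l
    proof -
      have "(\<Sum>k<m. B (v s) (a k) * B (a k) (a l)) = (\<Sum>k<m. if k = l then B (v s) (a l) else 0)"
        by (intro sum.cong refl) (use that in \<open>auto simp: orth\<close>)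
      then show ?thesis using that unfolding r_def lin_sum by simp
    qed
    show ?case
    proof (cases "B r r = 0")
      case True
      let ?e = "e(s := \<lambda>k. B (v s) (a k))"
      have "\<forall>s'\<in>insert s T. B (\<lambda>t. v s' t - (\<Sum>k<m. ?e s' k * a k t)) (\<lambda>t. v s' t - (\<Sum>k<m. ?e s' k * a k t)) = 0"
        using res True insert.hyps unfolding r_def by auto
      then show ?thesis using orth by blast
    next
      case False
      then have pos: "B r r > 0" using nonneg[of r] by simp
      define c where "c = sqrt (B r r)"
      have c: "c > 0" "c * c = B r r" using pos by (simp_all add: c_def)
      let ?a = "a(m := \<lambda>t. (1 / c) * r t)"
      \<comment> \<open>The new vector has coefficient \<open>c\<close> on its own normalised
        residual, which recovers it exactly; vectors treated earlier receive coefficient 0 in the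
        new direction.\<close>
      let ?e = "\<lambda>s'. if s' = s then (\<lambda>k. if k = m then c else B (v s) (a k)) else (e s')(m := 0)"
      have 1: "B (?a k) (?a l) = (if k = l then 1 else 0)" if "k < Suc m" "l < Suc m" for k l
      proof -
        have right: "B p (\<lambda>t. (1 / c) * r t) = (1 / c) * B r p" for p
          by (subst sym) (rule scale)
        have "B (\<lambda>t. (1 / c) * r t) (\<lambda>t. (1 / c) * r t) = 1 / c * (1 / c * B r r)"
          by (simp only: scale right)
        then have "B (\<lambda>t. (1 / c) * r t) (\<lambda>t. (1 / c) * r t) = 1"
          unfolding c(2)[symmetric] using c(1) by simp
        moreover have "B (\<lambda>t. (1 / c) * r t) (a j) = 0" "B (a j) (\<lambda>t. (1 / c) * r t) = 0" if "j < m" for j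
          unfolding right scale r_orth[OF that] by simp_all
        ultimately show ?thesis using that by (auto simp: less_Suc_eq orth)
      qed
      have 2: "B (\<lambda>t. v s' t - (\<Sum>k<Suc m. ?e s' k * ?a k t)) (\<lambda>t. v s' t - (\<Sum>k<Suc m. ?e s' k * ?a k t)) = 0"
        if "s' \<in> insert s T" for s'
      proof (cases "s' = s")
        case True
        have "(\<Sum>k<Suc m. ?e s k * ?a k t) = v s t" for t
        proof -
          have "(\<Sum>k<m. ?e s k * ?a k t) = (\<Sum>k<m. B (v s) (a k) * a k t)"
            by (intro sum.cong refl) auto
          then show ?thesis using c by (simp add: r_def)
        qed
        then show ?thesis using True by (simp add: zero)
      next
        case False
        have "(\<Sum>k<Suc m. ?e s' k * ?a k t) = (\<Sum>k<m. e s' k * a k t)" for t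
        proof -
          have "(\<Sum>k<m. ?e s' k * ?a k t) = (\<Sum>k<m. e s' k * a k t)"
            using False by (intro sum.cong refl) auto
          then show ?thesis using False by simp
        qed
        then show ?thesis using False that res by simp
      qed
      show ?thesis
        by (rule exI[of _ "Suc m"], rule exI[of _ ?a], rule exI[of _ ?e]) (use 1 2 in blast)
    qed
  qed
  then obtain m :: nat and a e where *: "(\<forall>k<m. \<forall>l<m. B (a k) (a l) = (if k = l then 1 else 0)) \<and>
      (\<forall>s\<in>T. B (\<lambda>t. v s t - (\<Sum>k<m. e s k * a k t)) (\<lambda>t. v s t - (\<Sum>k<m. e s k * a k t)) = 0)"
    by (elim exE)
  show thesis by (rule that[of m a e]) (use * in blast)+
qed

text \<open>The spectral input is condensed into two hypotheses. By \<open>degenerate\<close>, a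
  combination that is null for \<open>W\<close> is null for \<open>X\<close>, so coordinates
  orthonormal for \<open>W\<close> determine both fields on \<open>S\<close> almost surely;
  \<open>trace\<close> bounds the total size of the shift in these coordinates by a number
  \<open>\<tau>\<close> that does not depend on how many there are.\<close>

lemma (in prob_space) finite_dimensional_bound:
  fixes X W :: "'s \<Rightarrow> 'a \<Rightarrow> real"
  assumes S: "finite S" and L: "L > 0"
    and GX: "gaussian_field M X" and GW: "gaussian_field M W" and mean: "zero_mean M W"
    and ind: "independent_fields M X W"
    and degenerate: "\<And>b. (LINT x|M. (\<Sum>s\<in>S. b s * W s x)\<^sup>2) = 0 \<Longrightarrow> (LINT x|M. (\<Sum>s\<in>S. b s * X s x)\<^sup>2) = 0"
    and trace: "\<And>m (a :: nat \<Rightarrow> 's \<Rightarrow> real).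
      (\<And>p. (LINT x|M. (\<Sum>s\<in>S. (\<Sum>k<m. p k * a k s) * W s x)\<^sup>2) = (\<Sum>k<m. (p k)\<^sup>2))
      \<Longrightarrow> (\<Sum>k<m. (LINT x|M. (\<Sum>s\<in>S. a k s * X s x)\<^sup>2)) \<le> \<tau>"
    and Q: "Q \<in> sets (Pi\<^sub>M S (\<lambda>_. borel :: (real \<times> real) measure))"
  shows "emeasure M {x\<in>space M. (\<lambda>s\<in>S. (X s x, X s x * \<beta>2 + W s x)) \<in> Q}
    \<le> ennreal (exp L) * emeasure M {x\<in>space M. (\<lambda>s\<in>S. (X s x, X s x * \<beta>1 + W s x)) \<in> Q}
      + ennreal ((\<bar>\<beta>2 - \<beta>1\<bar> * (1 + \<tau>) / 2 + (\<beta>2 - \<beta>1)\<^sup>2 * \<tau> / 2) / L)"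
proof -
  define cX where "cX b x = (\<Sum>s\<in>S. b s * X s x)" for b x
  define cW where "cW b x = (\<Sum>s\<in>S. b s * W s x)" for b x
  have GcX: "gaussian_rv M (cX b)" and GcW: "gaussian_rv M (cW b)" for b
    unfolding cX_def[abs_def] cW_def[abs_def] using S GX GW unfolding gaussian_field_def by blast+
  have GXs: "gaussian_rv M (X s)" and GWs: "gaussian_rv M (W s)" for s
    by (intro gaussian_field_rv GX GW)+
  have [measurable]: "X s \<in> borel_measurable M" "W s \<in> borel_measurable M" for s
    using GXs GWs by (simp_all add: gaussian_rv_def)
  have [measurable]: "cX b \<in> borel_measurable M" "cW b \<in> borel_measurable M" for b
    unfolding cX_def[abs_def] cW_def[abs_def] by measurable
  define B where "B p q = (LINT x|M. cW p x * cW q x)" for p q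
  have cW_lin: "cW (\<lambda>t. p t + c * q t) x = cW p x + c * cW q x" for p c q x
    by (simp add: cW_def sum.distrib sum_distrib_left algebra_simps)
  have cW_sum: "cW (\<lambda>t. \<Sum>k<m. p k * a k t) x = (\<Sum>k<m. p k * cW (a k) x)" for p m x and a :: "nat \<Rightarrow> 's \<Rightarrow> real"
    unfolding cW_def by (simp add: sum_distrib_left sum_distrib_right mult.assoc) (rule sum.swap)
  have B_lin: "B (\<lambda>t. p t + c * q t) r = B p r + c * B q r" for p q r c
    unfolding B_def cW_lin using gaussian_rv_integrable_mult[OF GcW GcW]
    by (simp add: distrib_right mult.assoc)
  have B_sym: "B p q = B q p" for p q unfolding B_def by (simp add: mult.commute)
  have B_nonneg: "B p p \<ge> 0" for p unfolding B_def by simp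
  \<comment> \<open>Unit vectors: \<open>cW (v s)\<close> is \<open>W s\<close> itself, so
    orthogonalising them orthogonalises the observed values.\<close>
  define v where "v s t = (if t = s then 1 else 0 :: real)" for s t :: 's
  obtain m :: nat and a e where orth: "\<And>k l. k < m \<Longrightarrow> l < m \<Longrightarrow> B (a k) (a l) = (if k = l then 1 else 0)"
    and res: "\<And>s. s \<in> S \<Longrightarrow> B (\<lambda>t. v s t - (\<Sum>k<m. e s k * a k t)) (\<lambda>t. v s t - (\<Sum>k<m. e s k * a k t)) = 0"
    by (rule gram_schmidt_semidefinite[where B=B and v=v, OF S B_lin B_sym B_nonneg]) (rule that)
  let ?I = "{..<m}" and ?P = "Pi\<^sub>M {..<m} (\<lambda>_. borel :: real measure)"
  define \<xi> where "\<xi> x = (\<lambda>k\<in>?I. cX (a k) x)" for x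
  define \<zeta> where "\<zeta> x = (\<lambda>k\<in>?I. cW (a k) x)" for x
  have var: "(LINT x|M. (\<Sum>k<m. p k * cW (a k) x)\<^sup>2) = (\<Sum>k<m. (p k)\<^sup>2)" for p
  proof -
    have "(\<Sum>k<m. p k * cW (a k) x)\<^sup>2 = (\<Sum>k<m. \<Sum>l<m. (p k * p l) * (cW (a k) x * cW (a l) x))" for x
      unfolding power2_eq_square sum_product by (intro sum.cong refl) simp
    then have "(LINT x|M. (\<Sum>k<m. p k * cW (a k) x)\<^sup>2) = (\<Sum>k<m. \<Sum>l<m. (p k * p l) * B (a k) (a l))"
      using gaussian_rv_integrable_mult[OF GcW GcW] by (simp add: B_def)
    also have "\<dots> = (\<Sum>k<m. \<Sum>l<m. if k = l then (p k)\<^sup>2 else 0)"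
      by (intro sum.cong refl) (auto simp: orth power2_eq_square)
    finally show ?thesis by simp
  qed
  have ind': "indep_var ?P \<xi> ?P \<zeta>"
  proof -
    have m: "(\<lambda>f. \<lambda>k\<in>?I. \<Sum>s\<in>S. a k s * f s) \<in> measurable (Pi\<^sub>M UNIV (\<lambda>_. borel)) ?P" by measurable
    from indep_var_compose[OF ind[unfolded independent_fields_def] m m]
    show ?thesis by (simp add: o_def \<xi>_def[abs_def] \<zeta>_def[abs_def] cX_def cW_def)
  qed
  have law: "distr M ?P \<zeta> = Pi\<^sub>M ?I (\<lambda>_. std_normal_distribution)"
    unfolding \<zeta>_def[abs_def]
  proof (rule orthonormal_gaussian_law)
    show "gaussian_rv M (\<lambda>x. \<Sum>k<m. t k * cW (a k) x)" for t
      using GcW[of "\<lambda>s. \<Sum>k<m. t k * a k s"] unfolding cW_sum .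
    have "(LINT x|M. cW b x) = 0" for b
      using mean gaussian_rv_integrable(1)[OF GWs] unfolding cW_def zero_mean_def by simp
    from this[of "\<lambda>s. \<Sum>k<m. t k * a k s" for t] show "(LINT x|M. (\<Sum>k<m. t k * cW (a k) x)) = 0" for t
      unfolding cW_sum .
  qed (use var in auto)
  have AE_res: "AE x in M. X s x = (\<Sum>k<m. e s k * \<xi> x k) \<and> W s x = (\<Sum>k<m. e s k * \<zeta> x k)" if s: "s \<in> S" for s
  proof -
    let ?b = "\<lambda>t. v s t - (\<Sum>k<m. e s k * a k t)"
    have cW_b: "cW ?b x = W s x - (\<Sum>k<m. e s k * \<zeta> x k)" for x
    proof -
      have "cW ?b x = cW (v s) x - cW (\<lambda>t. \<Sum>k<m. e s k * a k t) x"
        by (simp add: cW_def left_diff_distrib sum_subtractf)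
      also have "cW (v s) x = W s x"
        using S s by (simp add: cW_def v_def if_distrib[where f="\<lambda>c. c * _"] cong: if_cong)
      finally show ?thesis by (simp add: cW_sum \<zeta>_def)
    qed
    have cX_b: "cX ?b x = X s x - (\<Sum>k<m. e s k * \<xi> x k)" for x
    proof -
      have "cX ?b x = cX (v s) x - cX (\<lambda>t. \<Sum>k<m. e s k * a k t) x"
        by (simp add: cX_def left_diff_distrib sum_subtractf)
      also have "cX (v s) x = X s x"
        using S s by (simp add: cX_def v_def if_distrib[where f="\<lambda>c. c * _"] cong: if_cong)
      also have "cX (\<lambda>t. \<Sum>k<m. e s k * a k t) x = (\<Sum>k<m. e s k * cX (a k) x)"
        unfolding cX_def by (simp add: sum_distrib_left sum_distrib_right mult.assoc) (rule sum.swap)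
      finally show ?thesis by (simp add: \<xi>_def)
    qed
    have null: "AE x in M. f x = 0" if "gaussian_rv M f" "(LINT x|M. (f x)\<^sup>2) = 0" for f
      using integral_nonneg_eq_0_iff_AE[OF gaussian_rv_integrable(2)[OF that(1)]] that(2) by auto
    have W0: "(LINT x|M. (cW ?b x)\<^sup>2) = 0" using res[OF s] unfolding B_def power2_eq_square .
    then have X0: "(LINT x|M. (cX ?b x)\<^sup>2) = 0" using degenerate[of ?b] unfolding cX_def cW_def by blast
    from null[OF GcW W0] null[OF GcX X0] show ?thesis by eventually_elim (simp add: cW_b cX_b)
  qed
  have AE_all: "AE x in M. \<forall>s\<in>S. X s x = (\<Sum>k<m. e s k * \<xi> x k) \<and> W s x = (\<Sum>k<m. e s k * \<zeta> x k)"
    by (rule AE_finite_allI[OF S AE_res])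
  \<comment> \<open>Rebuilds the observed values from the coordinates. Being linear, it sends the
    pair of \<open>\<xi>\<close> and \<open>\<beta> * \<xi> + \<zeta>\<close> to the pair of
    \<open>X\<close> and \<open>Y\<close> for every \<open>\<beta>\<close> at once, so the event
    \<open>Q\<close> can be pulled back along it.\<close>
  define H where "H p = (\<lambda>s\<in>S. (\<Sum>k<m. e s k * fst p k, \<Sum>k<m. e s k * snd p k))" for p :: "(nat \<Rightarrow> real) \<times> (nat \<Rightarrow> real)"
  have H[measurable]: "H \<in> measurable (?P \<Otimes>\<^sub>M ?P) (Pi\<^sub>M S (\<lambda>_. borel))"
    unfolding H_def[abs_def] borel_prod[symmetric] by measurable
  let ?Q = "H -` Q \<inter> space (?P \<Otimes>\<^sub>M ?P)"
  have Q': "?Q \<in> sets (?P \<Otimes>\<^sub>M ?P)" using Q H by measurable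
  have [measurable]: "\<xi> \<in> measurable M ?P" "\<zeta> \<in> measurable M ?P"
    unfolding \<xi>_def[abs_def] \<zeta>_def[abs_def] by measurable
  have path: "emeasure M {x\<in>space M. (\<lambda>s\<in>S. (X s x, X s x * \<beta> + W s x)) \<in> Q}
      = emeasure M {x\<in>space M. (\<xi> x, \<lambda>k\<in>?I. \<beta> * \<xi> x k + \<zeta> x k) \<in> ?Q}" for \<beta>
  proof (rule emeasure_eq_AE)
    have [measurable]: "(\<lambda>x. \<lambda>s\<in>S. (X s x, X s x * \<beta> + W s x)) \<in> measurable M (Pi\<^sub>M S (\<lambda>_. borel))"
      unfolding borel_prod[symmetric] by measurable
    note Q[measurable] Q'[measurable]
    show "{x\<in>space M. (\<lambda>s\<in>S. (X s x, X s x * \<beta> + W s x)) \<in> Q} \<in> sets M" by measurable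
    show "{x\<in>space M. (\<xi> x, \<lambda>k\<in>?I. \<beta> * \<xi> x k + \<zeta> x k) \<in> ?Q} \<in> sets M" by measurable
    show "AE x in M. x \<in> {x\<in>space M. (\<lambda>s\<in>S. (X s x, X s x * \<beta> + W s x)) \<in> Q}
        \<longleftrightarrow> x \<in> {x\<in>space M. (\<xi> x, \<lambda>k\<in>?I. \<beta> * \<xi> x k + \<zeta> x k) \<in> ?Q}"
      using AE_all
    proof eventually_elim
      case (elim x)
      have "H (\<xi> x, \<lambda>k\<in>?I. \<beta> * \<xi> x k + \<zeta> x k) = (\<lambda>s\<in>S. (X s x, X s x * \<beta> + W s x))"
        unfolding H_def
      proof (rule restrict_ext)
        fix s assume s: "s \<in> S"
        have "(\<Sum>k<m. e s k * (\<lambda>k\<in>?I. \<beta> * \<xi> x k + \<zeta> x k) k) = (\<Sum>k<m. \<beta> * (e s k * \<xi> x k) + e s k * \<zeta> x k)"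
          by (intro sum.cong refl) (simp add: algebra_simps)
        also have "\<dots> = X s x * \<beta> + W s x"
          using elim s by (simp add: sum.distrib sum_distrib_left[symmetric])
        finally show "(\<Sum>k<m. e s k * fst (\<xi> x, \<lambda>k\<in>?I. \<beta> * \<xi> x k + \<zeta> x k) k,
            \<Sum>k<m. e s k * snd (\<xi> x, \<lambda>k\<in>?I. \<beta> * \<xi> x k + \<zeta> x k) k) = (X s x, X s x * \<beta> + W s x)"
          using elim s by simp
      qed
      moreover have "(\<xi> x, \<lambda>k\<in>?I. \<beta> * \<xi> x k + \<zeta> x k) \<in> space (?P \<Otimes>\<^sub>M ?P)"
        by (simp add: space_pair_measure space_PiM \<xi>_def)
      ultimately show ?case by simp
    qed
  qed
  have tail: "emeasure M {x\<in>space M. (\<Sum>k<m. (\<beta>2 - \<beta>1) * \<xi> x k * \<zeta> x k + ((\<beta>2 - \<beta>1) * \<xi> x k)\<^sup>2 / 2) > L}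
      \<le> ennreal ((\<bar>\<beta>2 - \<beta>1\<bar> * (1 + \<tau>) / 2 + (\<beta>2 - \<beta>1)\<^sup>2 * \<tau> / 2) / L)"
  proof (rule log_likelihood_tail[OF _ L ind'])
    have "(\<Sum>k<m. (LINT x|M. (cX (a k) x)\<^sup>2)) \<le> \<tau>"
      unfolding cX_def by (rule trace) (use var in \<open>simp only: cW_sum[symmetric] cW_def[symmetric]\<close>)
    then show "(\<Sum>k<m. (LINT x|M. (\<xi> x k)\<^sup>2)) \<le> \<tau>" by (simp add: \<xi>_def)
  qed (use gaussian_rv_integrable_mult[OF GcX GcX] gaussian_rv_integrable_mult[OF GcW GcW] orth in \<open>simp_all add: \<xi>_def \<zeta>_def B_def\<close>)
  show ?thesis
    unfolding path
    using random_gaussian_shift_bound[OF _ ind' law Q', of \<beta>2 L \<beta>1] add_left_mono[OF tail]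
    by (meson finite_lessThan order_trans)
qed

section \<open>The path laws\<close>

text \<open>Zero mean makes covariances second moments, and the phase at \<open>s - t\<close> is the
  phase at \<open>s\<close> times the conjugate phase at \<open>t\<close>, so the double sum under
  the integral is a squared modulus.\<close>

lemma (in prob_space) spectral_second_moment:
  fixes Z :: "real ^ 'n \<Rightarrow> 'a \<Rightarrow> real"
  assumes Z: "stationary_gaussian_field M Z f" and S: "finite S"
  shows "(LINT x|M. (\<Sum>s\<in>S. b s * Z s x)\<^sup>2) = (LINT \<omega>|lborel. (cmod (trig_poly S b \<omega>))\<^sup>2 * f \<omega>)"
proof -
  obtain C where G: "gaussian_field M Z" and mean: "zero_mean M Z"
    and cov: "stationary_with_covariance M Z C" and spec: "spectral_density C f"
    using Z unfolding stationary_gaussian_field_def by blast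
  have f: "integrable lborel f" using spec by (simp add: spectral_density_def)
  have C: "(LINT x|M. Z s x * Z t x) = C (s - t)" for s t
  proof -
    have "covariance M (Z s) (Z t) = C (s - t)" using cov by (simp add: stationary_with_covariance_def)
    then show ?thesis using mean by (simp add: covariance_def zero_mean_def)
  qed
  have "(\<Sum>s\<in>S. b s * Z s x)\<^sup>2 = (\<Sum>s\<in>S. \<Sum>t\<in>S. (b s * b t) * (Z s x * Z t x))" for x
    unfolding power2_eq_square sum_product by (intro sum.cong refl) simp
  then have "(LINT x|M. (\<Sum>s\<in>S. b s * Z s x)\<^sup>2) = (\<Sum>s\<in>S. \<Sum>t\<in>S. (b s * b t) * C (s - t))"
    using gaussian_rv_integrable_mult[OF gaussian_field_rv[OF G] gaussian_field_rv[OF G]] by (simp add: C)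
  then have "complex_of_real (LINT x|M. (\<Sum>s\<in>S. b s * Z s x)\<^sup>2)
      = (\<Sum>s\<in>S. \<Sum>t\<in>S. of_real (b s * b t) * (LINT w|lborel. exp (\<i> * of_real ((s - t) \<bullet> w)) * of_real (f w)))"
    using spec by (simp add: spectral_density_def)
  also have "\<dots> = (LINT w|lborel. (\<Sum>s\<in>S. \<Sum>t\<in>S. of_real (b s * b t) * (exp (\<i> * of_real ((s - t) \<bullet> w)) * of_real (f w))))"
  proof -
    have i: "integrable lborel (\<lambda>w. exp (\<i> * of_real (h \<bullet> w)) * complex_of_real (f w))" for h
      by (rule Bochner_Integration.integrable_bound[OF f]) (use f in \<open>auto simp: norm_mult\<close>)
    show ?thesis
      by (subst Bochner_Integration.integral_sum, intro Bochner_Integration.integrable_sum integrable_mult_right i,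
          intro sum.cong refl, subst Bochner_Integration.integral_sum, intro integrable_mult_right i,
          intro sum.cong refl integral_mult_right_zero[symmetric])
  qed
  also have "(\<lambda>w::real ^ 'n. (\<Sum>s\<in>S. \<Sum>t\<in>S. of_real (b s * b t) * (exp (\<i> * of_real ((s - t) \<bullet> w)) * of_real (f w))))
      = (\<lambda>w. complex_of_real ((cmod (trig_poly S b w))\<^sup>2 * f w))"
  proof
    fix w :: "real ^ 'n"
    have e: "exp (\<i> * of_real ((s - t) \<bullet> w)) = exp (\<i> * of_real (s \<bullet> w)) * cnj (exp (\<i> * of_real (t \<bullet> w)))" for s t
      by (simp add: exp_cnj inner_diff_left exp_add[symmetric] algebra_simps)
    have "complex_of_real ((cmod (trig_poly S b w))\<^sup>2 * f w) = trig_poly S b w * cnj (trig_poly S b w) * of_real (f w)"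
      by (simp only: of_real_mult complex_norm_square)
    also have "\<dots> = (\<Sum>s\<in>S. \<Sum>t\<in>S. of_real (b s * b t) * (exp (\<i> * of_real ((s - t) \<bullet> w)) * of_real (f w)))"
      unfolding trig_poly_def cnj_sum by (subst sum_product) (simp add: sum_distrib_left e mult_ac del: exp_cnj)
    finally show "(\<Sum>s\<in>S. \<Sum>t\<in>S. of_real (b s * b t) * (exp (\<i> * of_real ((s - t) \<bullet> w)) * of_real (f w)))
        = complex_of_real ((cmod (trig_poly S b w))\<^sup>2 * f w)" ..
  qed
  finally show ?thesis unfolding integral_complex_of_real of_real_eq_iff .
qed

lemma (in prob_space) path_law_bound:
  fixes D :: "'s set" and X W :: "'s \<Rightarrow> 'a \<Rightarrow> real" and Y :: "real \<Rightarrow> 's \<Rightarrow> 'a \<Rightarrow> real"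
  assumes [measurable]: "\<And>s. X s \<in> borel_measurable M" "\<And>s. W s \<in> borel_measurable M"
    and Y: "\<And>\<beta> s x. s \<in> D \<Longrightarrow> Y \<beta> s x = X s x * \<beta> + W s x"
    and fin: "\<And>S Q. finite S \<Longrightarrow> S \<subseteq> D \<Longrightarrow> Q \<in> sets (Pi\<^sub>M S (\<lambda>_. borel :: (real \<times> real) measure)) \<Longrightarrow>
      emeasure M {x\<in>space M. (\<lambda>s\<in>S. (X s x, X s x * \<beta>2 + W s x)) \<in> Q}
      \<le> ennreal k * emeasure M {x\<in>space M. (\<lambda>s\<in>S. (X s x, X s x * \<beta>1 + W s x)) \<in> Q} + e"
    and A: "A \<in> sets (Pi\<^sub>M D (\<lambda>_. borel :: (real \<times> real) measure))"
  shows "emeasure (path_law M D X (Y \<beta>2)) A \<le> ennreal k * emeasure (path_law M D X (Y \<beta>1)) A + e"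
proof -
  define pr where "pr \<beta> J x = (\<lambda>s\<in>J. (X s x, X s x * \<beta> + W s x))" for \<beta> and J :: "'s set" and x
  have pr[measurable]: "pr \<beta> J \<in> measurable M (Pi\<^sub>M J (\<lambda>_. borel))" for \<beta> J
    unfolding pr_def[abs_def] borel_prod[symmetric] by measurable
  have law: "path_law M D X (Y \<beta>) = distr M (Pi\<^sub>M D (\<lambda>_. borel)) (pr \<beta> D)" for \<beta>
    unfolding path_law_def pr_def[abs_def] by (rule distr_cong) (auto simp: Y fun_eq_iff restrict_def)
  have prob: "prob_space (path_law M D X (Y \<beta>))" for \<beta>
    unfolding law by (rule prob_space_distr) (rule pr)
  \<comment> \<open>The family serves to provide the algebra of cylinder sets, which depends only on
    the index set and the value space; the parameter value 0 is an arbitrary choice.\<close>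
  interpret F: projective_family D "\<lambda>J. distr M (Pi\<^sub>M J (\<lambda>_. borel)) (pr 0 J)" "\<lambda>_::'s. borel :: (real \<times> real) measure"
  proof (rule projective_family.intro)
    fix J H :: "'s set" assume JH: "J \<subseteq> H"
    have "(\<lambda>f. restrict f J) \<circ> pr 0 H = pr 0 J" using JH by (auto simp: pr_def fun_eq_iff restrict_def)
    moreover have "(\<lambda>f. restrict f J) \<in> measurable (Pi\<^sub>M H (\<lambda>_. borel)) (Pi\<^sub>M J (\<lambda>_. borel :: (real \<times> real) measure))"
      by (rule measurable_restrict_subset) (rule JH)
    ultimately show "distr M (Pi\<^sub>M J (\<lambda>_. borel)) (pr 0 J)
        = distr (distr M (Pi\<^sub>M H (\<lambda>_. borel)) (pr 0 H)) (Pi\<^sub>M J (\<lambda>_. borel)) (\<lambda>f. restrict f J)"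
      by (simp add: distr_distr)
  qed (rule prob_space_distr, rule pr)
  have space: "space (path_law M D X (Y \<beta>)) = space (Pi\<^sub>M D (\<lambda>_. borel :: (real \<times> real) measure))"
    and sets: "sets (path_law M D X (Y \<beta>)) = sets (Pi\<^sub>M D (\<lambda>_. borel :: (real \<times> real) measure))" for \<beta>
    by (simp_all add: law)
  show ?thesis
  proof (rule bound_extends_from_generating_algebra)
    show "finite_measure (path_law M D X (Y \<beta>1))" "finite_measure (path_law M D X (Y \<beta>2))"
      using prob by (simp_all add: prob_space.finite_measure)
    show "algebra (space (path_law M D X (Y \<beta>1))) F.generator"
      unfolding space by (rule F.algebra_generator)
    show "sets (path_law M D X (Y \<beta>1)) = sigma_sets (space (path_law M D X (Y \<beta>1))) F.generator"
      unfolding space sets by (rule F.sets_PiM_generator)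
    fix B assume "B \<in> F.generator"
    then obtain J Q where J: "finite J" "J \<subseteq> D" and Q[measurable]: "Q \<in> sets (Pi\<^sub>M J (\<lambda>_. borel :: (real \<times> real) measure))"
      and B: "B = prod_emb D (\<lambda>_. borel) J Q" by (auto elim!: F.generator.cases)
    have Bm: "B \<in> sets (Pi\<^sub>M D (\<lambda>_. borel))"
      unfolding B by (rule measurable_prod_emb) (use J Q in auto)
    have "emeasure (path_law M D X (Y \<beta>)) B = emeasure M {x\<in>space M. (\<lambda>s\<in>J. (X s x, X s x * \<beta> + W s x)) \<in> Q}" for \<beta>
    proof -
      have "restrict (pr \<beta> D x) J = (\<lambda>s\<in>J. (X s x, X s x * \<beta> + W s x))" for x
        using J by (auto simp: pr_def fun_eq_iff restrict_def)
      moreover have "pr \<beta> D x \<in> extensional D" for x by (simp add: pr_def)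
      ultimately have "pr \<beta> D -` B \<inter> space M = {x\<in>space M. (\<lambda>s\<in>J. (X s x, X s x * \<beta> + W s x)) \<in> Q}"
        by (auto simp: B prod_emb_def PiE_def)
      then show ?thesis unfolding law by (subst emeasure_distr[OF pr Bm]) simp
    qed
    then show "emeasure (path_law M D X (Y \<beta>2)) B \<le> ennreal k * emeasure (path_law M D X (Y \<beta>1)) B + e"
      using fin[OF J Q] by simp
  qed (use A in \<open>simp_all add: sets\<close>)
qed

section \<open>Equivalence and inconsistency from the quantitative bound\<close>

lemma absolutely_continuous_of_bound:
  assumes sets: "sets P = sets Q"
    and bound: "\<And>A L. A \<in> sets P \<Longrightarrow> L > 0 \<Longrightarrow> emeasure Q A \<le> ennreal (exp L) * emeasure P A + ennreal (K / L)"
  shows "absolutely_continuous P Q"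
  unfolding absolutely_continuous_def
proof
  fix A assume A: "A \<in> null_sets P"
  have "emeasure Q A \<le> 0"
  proof (rule ennreal_le_epsilon)
    fix \<epsilon> :: real assume \<epsilon>: "\<epsilon> > 0"
    \<comment> \<open>On a null set of \<open>P\<close> the factor \<open>exp L\<close> does no
      harm, so \<open>L\<close> may be taken as large as \<open>\<epsilon>\<close> requires;
      \<open>\<bar>K\<bar> + 1\<close> keeps it positive whatever \<open>K\<close> is.\<close>
    have L: "(\<bar>K\<bar> + 1) / \<epsilon> > 0" using \<epsilon> by simp
    have "K / ((\<bar>K\<bar> + 1) / \<epsilon>) \<le> \<epsilon>"
      using \<epsilon> L by (subst pos_divide_le_eq) auto
    moreover have "emeasure Q A \<le> ennreal (K / ((\<bar>K\<bar> + 1) / \<epsilon>))"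
      using bound[OF _ L, of A] A by (auto simp: null_sets_def)
    ultimately show "emeasure Q A \<le> 0 + ennreal \<epsilon>"
      by (metis add_0 ennreal_leI order_trans)
  qed
  then show "A \<in> null_sets Q" using A sets by (auto simp: null_sets_def)
qed

text \<open>Two parameter values suffice. Consistency makes the event that the estimate is far from
  0 negligible under \<open>P 0\<close> and almost certain under \<open>P 1\<close>, whereas the
  bound with one fixed \<open>L\<close> allows it under \<open>P 1\<close> a limiting probability of
  at most \<open>K / L\<close>.\<close>

lemma no_consistent_estimator_of_bound:
  fixes P :: "real \<Rightarrow> 'b measure"
  assumes prob: "\<And>\<beta>. prob_space (P \<beta>)" and sets: "sets (P 0) = sets (P 1)" and K: "K \<ge> 0"
    and bound: "\<And>A L. A \<in> sets (P 0) \<Longrightarrow> L > 0 \<Longrightarrow> emeasure (P 1) A \<le> ennreal (exp L) * emeasure (P 0) A + ennreal (K / L)"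
  shows "\<not> consistent_estimator P T"
proof
  assume T: "consistent_estimator P T"
  interpret P0: prob_space "P 0" by (rule prob)
  interpret P1: prob_space "P 1" by (rule prob)
  have space: "space (P 0) = space (P 1)" using sets by (rule sets_eq_imp_space_eq)
  have [measurable]: "T n \<in> borel_measurable (P 0)" "T n \<in> borel_measurable (P 1)" for n
    using T by (auto simp: consistent_estimator_def)
  have conv: "\<epsilon> > 0 \<Longrightarrow> (\<lambda>n. measure (P \<beta>) {p \<in> space (P \<beta>). \<bar>T n p - \<beta>\<bar> > \<epsilon>}) \<longlonglongrightarrow> 0" for \<beta> \<epsilon>
    using T by (auto simp: consistent_estimator_def)
  \<comment> \<open>The radii 1/2 around 0 and 1/4 around 1 give disjoint intervals, so no estimate
    avoids both \<open>B n\<close> and \<open>C n\<close>.\<close>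
  define B where "B n = {p \<in> space (P 0). \<bar>T n p - 0\<bar> > 1/2}" for n
  define C where "C n = {p \<in> space (P 1). \<bar>T n p - 1\<bar> > 1/4}" for n
  have B0: "(\<lambda>n. measure (P 0) (B n)) \<longlonglongrightarrow> 0" unfolding B_def by (rule conv) simp
  have C1: "(\<lambda>n. measure (P 1) (C n)) \<longlonglongrightarrow> 0" unfolding C_def by (rule conv) simp
  have Bm: "B n \<in> sets (P 0)" "B n \<in> sets (P 1)" for n
    unfolding sets[symmetric] by (simp_all add: B_def)
  have Cm: "C n \<in> sets (P 1)" for n by (simp add: C_def)
  \<comment> \<open>Chosen so that \<open>K / L\<close> stays below 1, in fact below 1/2, and
    \<open>L\<close> is positive even for \<open>K = 0\<close>.\<close>
  define L where "L = 2 * K + 1"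
  have L: "L > 0" using K by (simp add: L_def)
  have "1 \<le> exp L * measure (P 0) (B n) + K / L + measure (P 1) (C n)" for n
  proof -
    have "\<bar>t - 0\<bar> > 1/2 \<or> \<bar>t - 1\<bar> > 1/4" for t :: real by arith
    then have "space (P 1) \<subseteq> B n \<union> C n" unfolding B_def C_def space by blast
    then have "measure (P 1) (space (P 1)) \<le> measure (P 1) (B n \<union> C n)"
      using Bm Cm by (intro P1.finite_measure_mono) auto
    also have "\<dots> \<le> measure (P 1) (B n) + measure (P 1) (C n)"
      using Bm Cm by (intro measure_Un_le)
    finally have "1 \<le> measure (P 1) (B n) + measure (P 1) (C n)" by (simp add: P1.prob_space)
    moreover have "ennreal (measure (P 1) (B n)) \<le> ennreal (exp L * measure (P 0) (B n) + K / L)"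
      using bound[OF Bm(1) L] K L
      by (simp add: P0.emeasure_eq_measure P1.emeasure_eq_measure ennreal_mult ennreal_plus)
    then have "measure (P 1) (B n) \<le> exp L * measure (P 0) (B n) + K / L"
      using K L by (subst (asm) ennreal_le_iff) auto
    ultimately show ?thesis by simp
  qed
  moreover have "(\<lambda>n. exp L * measure (P 0) (B n) + K / L + measure (P 1) (C n)) \<longlonglongrightarrow> exp L * 0 + K / L + 0"
    by (intro tendsto_intros B0 C1)
  ultimately have "1 \<le> exp L * 0 + K / L + 0"
    by (intro LIMSEQ_le_const[where X="\<lambda>n. exp L * measure (P 0) (B n) + K / L + measure (P 1) (C n)"]) auto
  then show False using L K by (simp add: L_def divide_simps)
qed

theorem theorem5:
  fixes D Dstar :: "(real ^ 'n) set"
    and M :: "'a measure"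
    and X W :: "real ^ 'n \<Rightarrow> 'a \<Rightarrow> real"
    and Y :: "real \<Rightarrow> real ^ 'n \<Rightarrow> 'a \<Rightarrow> real"
    and fX fW \<phi>X \<phi>W :: "real ^ 'n \<Rightarrow> real"
    and c1 c2 :: real
  assumes "bounded D" and "\<exists>z r. r > 0 \<and> ball z r \<subseteq> D"
    and "prob_space M"
    and "stationary_gaussian_field M X fX" and "stationary_gaussian_field M W fW"
    and "independent_fields M X W"
    and "\<And>\<beta> s x. s \<in> D \<Longrightarrow> Y \<beta> s x = X s x * \<beta> + W s x"
    and "\<forall>w. fX w > 0" and "\<forall>w. fW w > 0"
    and "continuous_on UNIV fX" and "continuous_on UNIV fW"
    and "bounded_away_from_0_and_infinity_at_origin fX"
    and "bounded_away_from_0_and_infinity_at_origin fW"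
    and "c1 > 0" and "c2 > 0"
    and "\<forall>w. \<phi>X w > 0" and "\<forall>w. \<phi>W w > 0"
    and "\<forall>w. c1 * (\<phi>X w)\<^sup>2 \<le> fX w \<and> fX w \<le> c2 * (\<phi>X w)\<^sup>2"
    and "\<forall>w. c1 * (\<phi>W w)\<^sup>2 \<le> fW w \<and> fW w \<le> c2 * (\<phi>W w)\<^sup>2"
    and "bounded Dstar" and "D \<subseteq> Dstar"
    and "fourier_transform_of_L2_supported_in Dstar \<phi>X"
    and "fourier_transform_of_L2_supported_in Dstar \<phi>W"
    and "bdd_above (range (\<lambda>w. fX w / fW w))"
    and "(\<integral>\<^sup>+ w. ennreal (fX w / fW w) \<partial>lborel) < \<infinity>"
  shows "(\<forall>\<beta>1 \<beta>2. equivalent_measures (path_law M D X (Y \<beta>1)) (path_law M D X (Y \<beta>2)))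
    \<and> (\<nexists>T. consistent_estimator (\<lambda>\<beta>. path_law M D X (Y \<beta>)) T)"
proof -
  interpret prob_space M by fact
  note X = \<open>stationary_gaussian_field M X fX\<close> and W = \<open>stationary_gaussian_field M W fW\<close>
  have GX: "gaussian_field M X" and GW: "gaussian_field M W" and mean: "zero_mean M W"
    and fX: "integrable lborel fX" and fW: "integrable lborel fW"
    using X W by (auto simp: stationary_gaussian_field_def spectral_density_def)
  have pos: "fX w > 0" "fW w > 0" for w using \<open>\<forall>w. fX w > 0\<close> \<open>\<forall>w. fW w > 0\<close> by auto
  have [measurable]: "X s \<in> borel_measurable M" "W s \<in> borel_measurable M" for s
    using gaussian_field_rv[OF GX] gaussian_field_rv[OF GW] by (simp_all add: gaussian_rv_def)
  have [measurable]: "fX \<in> borel_measurable borel" "fW \<in> borel_measurable borel"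
    using fX fW by simp_all
  have ratio: "integrable lborel (\<lambda>w. fX w / fW w)"
    using \<open>(\<integral>\<^sup>+ w. ennreal (fX w / fW w) \<partial>lborel) < \<infinity>\<close>
    by (intro integrableI_nonneg AE_I2) (auto simp: pos less_imp_le)
  obtain C where C: "C \<ge> 0" "\<And>S a w. S \<subseteq> D \<Longrightarrow>
      (cmod (trig_poly S a w))\<^sup>2 * fW w \<le> C * (LINT \<omega>|lborel. (cmod (trig_poly S a \<omega>))\<^sup>2 * fW \<omega>)"
    by (rule trig_poly_pointwise_bound[OF \<open>bounded Dstar\<close> \<open>D \<subseteq> Dstar\<close>
          \<open>fourier_transform_of_L2_supported_in Dstar \<phi>W\<close> \<open>c1 > 0\<close> \<open>c2 > 0\<close>
          \<open>\<forall>w. c1 * (\<phi>W w)\<^sup>2 \<le> fW w \<and> fW w \<le> c2 * (\<phi>W w)\<^sup>2\<close>[rule_format] fW]) (rule that)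
  \<comment> \<open>\<open>C\<close> was obtained before any finite set of points was chosen, so
    \<open>\<tau>\<close> serves all finite subsets of \<open>D\<close>; this is what allows the
    passage to the path laws.\<close>
  define \<tau> where "\<tau> = 2 * C * (LINT w|lborel. fX w / fW w)"
  have \<tau>: "\<tau> \<ge> 0" unfolding \<tau>_def using C(1) pos by (intro mult_nonneg_nonneg integral_nonneg_AE AE_I2) (auto simp: less_imp_le)
  define K where "K \<beta>1 \<beta>2 = \<bar>\<beta>2 - \<beta>1\<bar> * (1 + \<tau>) / 2 + (\<beta>2 - \<beta>1)\<^sup>2 * \<tau> / 2" for \<beta>1 \<beta>2
  have K: "K \<beta>1 \<beta>2 \<ge> 0" for \<beta>1 \<beta>2 unfolding K_def using \<tau> by simp
  have bound: "emeasure (path_law M D X (Y \<beta>2)) A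
      \<le> ennreal (exp L) * emeasure (path_law M D X (Y \<beta>1)) A + ennreal (K \<beta>1 \<beta>2 / L)"
    if A: "A \<in> sets (Pi\<^sub>M D (\<lambda>_. borel))" and L: "L > 0" for A L \<beta>1 \<beta>2
  proof (rule path_law_bound)
    fix S Q assume S: "finite S" "S \<subseteq> D" and Q: "Q \<in> sets (Pi\<^sub>M S (\<lambda>_. borel :: (real \<times> real) measure))"
    note sX = spectral_second_moment[OF X S(1)] and sW = spectral_second_moment[OF W S(1)]
    show "emeasure M {x\<in>space M. (\<lambda>s\<in>S. (X s x, X s x * \<beta>2 + W s x)) \<in> Q}
        \<le> ennreal (exp L) * emeasure M {x\<in>space M. (\<lambda>s\<in>S. (X s x, X s x * \<beta>1 + W s x)) \<in> Q} + ennreal (K \<beta>1 \<beta>2 / L)"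
      unfolding K_def
    proof (rule finite_dimensional_bound[OF S(1) L GX GW mean \<open>independent_fields M X W\<close> _ _ Q])
      fix b assume "(LINT x|M. (\<Sum>s\<in>S. b s * W s x)\<^sup>2) = 0"
      \<comment> \<open>Since \<open>fW\<close> is positive, a null combination of the
        \<open>W s\<close> has a trigonometric polynomial vanishing almost everywhere, and this
        makes the same combination of the \<open>X s\<close> null.\<close>
      then have "AE w in lborel. (cmod (trig_poly S b w))\<^sup>2 * fW w = 0"
        unfolding sW by (subst (asm) integral_nonneg_eq_0_iff_AE[OF integrable_trig_poly_square[OF fW]])
          (auto simp: pos less_imp_le)
      then have "AE w in lborel. (cmod (trig_poly S b w))\<^sup>2 * fX w = 0"
        by eventually_elim (use pos in \<open>auto simp: less_le\<close>)
      then have "(LINT w|lborel. (cmod (trig_poly S b w))\<^sup>2 * fX w) = (LINT w::real ^ 'n|lborel. 0)"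
        by (intro integral_cong_AE) auto
      then show "(LINT x|M. (\<Sum>s\<in>S. b s * X s x)\<^sup>2) = 0" unfolding sX by simp
    next
      fix m and a :: "nat \<Rightarrow> real ^ 'n \<Rightarrow> real"
      assume "\<And>p. (LINT x|M. (\<Sum>s\<in>S. (\<Sum>k<m. p k * a k s) * W s x)\<^sup>2) = (\<Sum>k<m. (p k)\<^sup>2)"
      then show "(\<Sum>k<m. (LINT x|M. (\<Sum>s\<in>S. a k s * X s x)\<^sup>2)) \<le> \<tau>"
        unfolding sX sW \<tau>_def
        by (intro trace_bound C(1) C(2)[OF S(2)] fX ratio) (auto simp: pos less_imp_le)
    qed
  qed (use A assms(7) in auto)
  have sets: "sets (path_law M D X (Y \<beta>)) = sets (Pi\<^sub>M D (\<lambda>_. borel))" for \<beta>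
    by (simp add: path_law_def)
  have "absolutely_continuous (path_law M D X (Y \<beta>1)) (path_law M D X (Y \<beta>2))" for \<beta>1 \<beta>2
    by (rule absolutely_continuous_of_bound[where K="K \<beta>1 \<beta>2"]) (simp_all add: sets bound)
  moreover have "\<not> consistent_estimator (\<lambda>\<beta>. path_law M D X (Y \<beta>)) T" for T
  proof (rule no_consistent_estimator_of_bound[where K="K 0 1"])
    show "prob_space (path_law M D X (Y \<beta>))" for \<beta>
      unfolding path_law_def
    proof (rule prob_space_distr)
      have "(\<lambda>x. \<lambda>s\<in>D. (X s x, Y \<beta> s x)) = (\<lambda>x. \<lambda>s\<in>D. (X s x, X s x * \<beta> + W s x))"
        using assms(7) by (auto simp: fun_eq_iff restrict_def)
      also have "\<dots> \<in> measurable M (Pi\<^sub>M D (\<lambda>_. borel))"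
        unfolding borel_prod[symmetric] by measurable
      finally show "(\<lambda>x. \<lambda>s\<in>D. (X s x, Y \<beta> s x)) \<in> measurable M (Pi\<^sub>M D (\<lambda>_. borel))" .
    qed
  qed (simp_all add: sets bound K)
  ultimately show ?thesis by (simp add: equivalent_measures_def sets)
qed

end
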